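(* There is a polynomial-time reduction that transforms any bipartite graph $G'$ into an instance $\mathcal P=(G,\{c_\ell\}_{\ell\in L},\{\preceq_a\}_{a\in A})$ of the donation center location problem, with $G=(A\cup L,E)$, such that $$\mathrm{im}(G')\le\mathrm{OPT}(\mathcal P)\le\mathrm{sim}(G').$$ Moreover, $|V(G)|=|V(G')|$, $c_\ell=1$ for all $\ell\in L$, and $\preceq_a=\preceq^*$ for all $a\in A$, where $\preceq^*$ is some global preference (a single ranking of $L$ shared by all agents).
   Context: Donation center location problem: an instance is a triple $(G=(A\cup L,E),\{c_\ell\}_{\ell\in L},\{\preceq_a\}_{a\in A})$, where $G$ is a bipartite graph with edges directed from the set $A$ of agents to the set $L$ of centers, $c_\ell\in\mathbb Z$ is the capacity of center $\ell$, and $\preceq_a$ is a strict preference ranking of agent $a$ over its neighbors in $L$ (when a global ranking of $L$ is given, agent $a$ uses its restriction to its neighbors). A solution consists of $L'\subseteq L$ (opened centers), $A'\subseteq A$ and an assignment of each $a\in A'$ to a center such that (1) at most $c_\ell$ agents are assigned to each $\ell$, and (2) each $a\in A'$ is assigned to its highest-ranked neighbor in $L'$. The value is $|A'|$; $\mathrm{OPT}(\mathcal P)$ is the maximum value. $\mathrm{im}(G')$ is the maximum size of an induced matching of $G'$, i.e. a matching such that no two distinct edges of it are joined by an edge of $G'$. For a total order $\sigma$ on the vertices (a bijection $V(G')\to\{1,\dots,|V(G')|\}$), a matching $\mathcal M$ is $\sigma$-semi-induced if for any pair of edges $uu',vv'\in\mathcal M$ with $\sigma(u)<\sigma(u')$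 and $\sigma(u)<\sigma(v)<\sigma(v')$, neither $uv$ nor $uv'$ is an edge. $\mathrm{sim}(G')$ is the maximum over all $\sigma$ of the maximum size of a $\sigma$-semi-induced matching in $G'$. *)

theory Defs
  imports Complex_Main "HOL-Computational_Algebra.Polynomial"
begin

section \<open>Undirected graphs and their matchings\<close>

record 'v ugraph =
  verts :: "'v set"
  edges :: "'v set set"

definition simple_graph :: "'v ugraph \<Rightarrow> bool" where
  "simple_graph G \<longleftrightarrow> finite (verts G) \<and> (\<forall>e\<in>edges G. e \<subseteq> verts G \<and> card e = 2)"

definition bipartite :: "'v ugraph \<Rightarrow> bool" where
  "bipartite G \<longleftrightarrow> (\<exists>X Y. X \<union> Y = verts G \<and> X \<inter> Y = {} \<and>
     (\<forall>e\<in>edges G. \<exists>x\<in>X. \<exists>y\<in>Y. e = {x, y}))"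

definition matching :: "'v ugraph \<Rightarrow> 'v set set \<Rightarrow> bool" where
  "matching G M \<longleftrightarrow> M \<subseteq> edges G \<and> (\<forall>e\<in>M. \<forall>f\<in>M. e \<noteq> f \<longrightarrow> e \<inter> f = {})"

definition induced_matching :: "'v ugraph \<Rightarrow> 'v set set \<Rightarrow> bool" where
  "induced_matching G M \<longleftrightarrow> matching G M \<and>
     (\<forall>e\<in>M. \<forall>f\<in>M. e \<noteq> f \<longrightarrow> (\<forall>u\<in>e. \<forall>v\<in>f. {u, v} \<notin> edges G))"

definition im :: "'v ugraph \<Rightarrow> nat" where
  "im G = Max {card M | M. induced_matching G M}"

definition vertex_order :: "'v ugraph \<Rightarrow> ('v \<Rightarrow> nat) \<Rightarrow> bool" where
  "vertex_order G \<sigma> \<longleftrightarrow> bij_betw \<sigma> (verts G) {1..card (verts G)}"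

definition semi_induced_matching :: "'v ugraph \<Rightarrow> ('v \<Rightarrow> nat) \<Rightarrow> 'v set set \<Rightarrow> bool" where
  "semi_induced_matching G \<sigma> M \<longleftrightarrow> matching G M \<and>
     (\<forall>u u' v v'. {u, u'} \<in> M \<and> {v, v'} \<in> M \<and> \<sigma> u < \<sigma> u' \<and> \<sigma> u < \<sigma> v \<and> \<sigma> v < \<sigma> v' \<longrightarrow>
        {u, v} \<notin> edges G \<and> {u, v'} \<notin> edges G)"

definition sim_wrt :: "'v ugraph \<Rightarrow> ('v \<Rightarrow> nat) \<Rightarrow> nat" where
  "sim_wrt G \<sigma> = Max {card M | M. semi_induced_matching G \<sigma> M}"

definition sim :: "'v ugraph \<Rightarrow> nat" where
  "sim G = Max {sim_wrt G \<sigma> | \<sigma>. vertex_order G \<sigma>}"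


section \<open>The donation center location problem\<close>

text \<open>
  A pair \<open>(x, y) \<in> pref P a\<close> means \<open>x \<preceq>\<^sub>a y\<close>, that is, agent \<open>a\<close> ranks \<open>y\<close> at least as
  high as \<open>x\<close>. Strictness of the ranking is antisymmetry of this relation.
\<close>

record 'v dcl_instance =
  agents :: "'v set"
  centers :: "'v set"
  arcs :: "('v \<times> 'v) set"
  cap :: "'v \<Rightarrow> int"
  pref :: "'v \<Rightarrow> ('v \<times> 'v) set"

definition nbrs :: "'v dcl_instance \<Rightarrow> 'v \<Rightarrow> 'v set" where
  "nbrs P a = {l. (a, l) \<in> arcs P}"

definition dcl_verts :: "'v dcl_instance \<Rightarrow> 'v set" where
  "dcl_verts P = agents P \<union> centers P"

definition valid_dcl :: "'v dcl_instance \<Rightarrow> bool" where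
  "valid_dcl P \<longleftrightarrow> finite (agents P) \<and> finite (centers P) \<and> agents P \<inter> centers P = {} \<and>
     arcs P \<subseteq> agents P \<times> centers P \<and>
     (\<forall>a\<in>agents P. linear_order_on (nbrs P a) (pref P a))"

definition dcl_solution ::
  "'v dcl_instance \<Rightarrow> 'v set \<Rightarrow> 'v set \<Rightarrow> ('v \<Rightarrow> 'v) \<Rightarrow> bool" where
  "dcl_solution P L' A' f \<longleftrightarrow> L' \<subseteq> centers P \<and> A' \<subseteq> agents P \<and>
     (\<forall>l\<in>centers P. int (card {a\<in>A'. f a = l}) \<le> cap P l) \<and>
     (\<forall>a\<in>A'. f a \<in> nbrs P a \<inter> L' \<and> (\<forall>l\<in>nbrs P a \<inter> L'. (l, f a) \<in> pref P a))"

definition OPT :: "'v dcl_instance \<Rightarrow> nat" where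
  "OPT P = Max {card A' | L' A' f. dcl_solution P L' A' f}"


section \<open>Polynomial-time computable functions\<close>

text \<open>
  Deterministic multi-tape Turing machines. Tapes are infinite in both directions, states and
  tape symbols are initial segments of the natural numbers, symbol \<open>0\<close> is the blank, and \<open>1\<close>
  and \<open>2\<close> stand for the bits. The transition function receives the current state and the
  scanned symbols, and returns the new state together with, for each tape, the symbol to be
  written and the head movement. Tape \<open>0\<close> is the input tape, tape \<open>1\<close> is the output tape.
\<close>

record tm =
  num_tapes :: nat
  num_symbols :: nat
  num_states :: nat
  start :: nat
  halt :: nat
  delta :: "nat \<Rightarrow> nat list \<Rightarrow> nat \<times> (nat \<times> int) list"

definition wf_tm :: "tm \<Rightarrow> bool" where
  "wf_tm M \<longleftrightarrow> 2 \<le> num_tapes M \<and> 3 \<le> num_symbols M \<and>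
     start M < num_states M \<and> halt M < num_states M \<and>
     (\<forall>q ss. q < num_states M \<and> length ss = num_tapes M \<and> set ss \<subseteq> {..<num_symbols M} \<longrightarrow>
        (case delta M q ss of (q', as) \<Rightarrow>
           q' < num_states M \<and> length as = num_tapes M \<and>
           set as \<subseteq> {..<num_symbols M} \<times> {-1, 0, 1}))"

text \<open>A tape is given by its contents and the position of its head.\<close>

type_synonym tape = "(int \<Rightarrow> nat) \<times> int"
type_synonym config = "nat \<times> tape list"

fun scan :: "tape \<Rightarrow> nat" where
  "scan (t, h) = t h"

fun act :: "nat \<times> int \<Rightarrow> tape \<Rightarrow> tape" where
  "act (s, d) (t, h) = (t(h := s), h + d)"

fun step :: "tm \<Rightarrow> config \<Rightarrow> config" where
  "step M (q, ts) =
     (if q = halt M then (q, ts)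
      else case delta M q (map scan ts) of (q', as) \<Rightarrow> (q', map2 act as ts))"

definition word_tape :: "bool list \<Rightarrow> int \<Rightarrow> nat" where
  "word_tape w i = (if 0 \<le> i \<and> i < int (length w) then (if w ! nat i then 2 else 1) else 0)"

definition init_config :: "tm \<Rightarrow> bool list \<Rightarrow> config" where
  "init_config M w =
     (start M, (word_tape w, 0) # replicate (num_tapes M - 1) (word_tape [], 0))"

definition outputs_within :: "tm \<Rightarrow> bool list \<Rightarrow> nat \<Rightarrow> bool list \<Rightarrow> bool" where
  "outputs_within M w t v \<longleftrightarrow>
     (case (step M ^^ t) (init_config M w) of (q, ts) \<Rightarrow>
        q = halt M \<and> fst (ts ! 1) = word_tape v)"

definition polytime_computable_on ::
  "'a set \<Rightarrow> ('a \<Rightarrow> bool list) \<Rightarrow> ('b \<Rightarrow> bool list) \<Rightarrow> ('a \<Rightarrow> 'b) \<Rightarrow> bool" where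
  "polytime_computable_on D enc enc' f \<longleftrightarrow>
     (\<exists>M (p :: nat poly). wf_tm M \<and>
        (\<forall>x\<in>D. outputs_within M (enc x) (poly p (length (enc x))) (enc' (f x))))"


section \<open>Encodings as bit strings\<close>

text \<open>
  Graphs and instances that are encoded have vertex set \<open>{..<n}\<close>. A graph is encoded by \<open>n\<close> in
  unary followed by its adjacency matrix; in particular, no bipartition is part of the
  encoding of a bipartite graph.
\<close>

definition enc_unary :: "nat \<Rightarrow> bool list" where
  "enc_unary n = replicate n True @ [False]"

definition encodable_ugraph :: "nat ugraph \<Rightarrow> bool" where
  "encodable_ugraph G \<longleftrightarrow> verts G = {..<card (verts G)}"

definition enc_ugraph :: "nat ugraph \<Rightarrow> bool list" where
  "enc_ugraph G = (let n = card (verts G) in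
     enc_unary n @ [{u, v} \<in> edges G. u \<leftarrow> [0..<n], v \<leftarrow> [0..<n]])"

text \<open>
  Capacities are written in binary, least significant bit first. Each binary digit is preceded
  by \<open>True\<close>, and \<open>False\<close> marks the end, so that the code is self-delimiting.
\<close>

fun enc_nat :: "nat \<Rightarrow> bool list" where
  "enc_nat n = (if n = 0 then [False] else True # odd n # enc_nat (n div 2))"

declare enc_nat.simps [simp del]

definition enc_int :: "int \<Rightarrow> bool list" where
  "enc_int z = (z < 0) # enc_nat (nat \<bar>z\<bar>)"

definition encodable_dcl :: "nat dcl_instance \<Rightarrow> bool" where
  "encodable_dcl P \<longleftrightarrow> dcl_verts P = {..<card (dcl_verts P)}"

text \<open>
  An instance is encoded by \<open>n\<close> in unary, the indicator vector of the agents, the adjacency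
  matrix of the arcs, the capacities of the centers, and, for every agent, the matrix of its
  preference relation.
\<close>

definition enc_dcl :: "nat dcl_instance \<Rightarrow> bool list" where
  "enc_dcl P = (let n = card (dcl_verts P) in
     enc_unary n @
     [v \<in> agents P. v \<leftarrow> [0..<n]] @
     [(u, v) \<in> arcs P. u \<leftarrow> [0..<n], v \<leftarrow> [0..<n]] @
     concat [enc_int (cap P l). l \<leftarrow> [0..<n], l \<in> centers P] @
     [(x, y) \<in> pref P a. a \<leftarrow> [0..<n], a \<in> agents P, x \<leftarrow> [0..<n], y \<leftarrow> [0..<n]])"

end

theory Submission
  imports Defs
begin

text \<open>
  Split \<open>G'\<close> by a proper 2-colouring into agents and centers, keep its edges as arcs, and let all
  agents share an arbitrary ranking of the centers (here \<open>\<le>\<close>). For an induced matching, opening its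
  centers leaves every matched agent with a single open neighbour, so \<open>im \<le> OPT\<close>. Conversely, an
  agent of a solution has no arc to an open center better than its own; ordering the assigned agents
  from the worst assigned center to the best, with all other vertices behind, makes the assignment a
  semi-induced matching, so \<open>OPT \<le> sim\<close>.

  The 2-colouring is found by \<open>n\<close> phases, each of which colours the first uncoloured vertex and then
  propagates colours along all edges \<open>n\<close> times. Throughout, the partial colouring extends to a proper
  one. The Turing machine is obtained from a while program over six tapes; its control states are
  the finitely many continuations of that program.
\<close>

section \<open>While programs and Turing machines\<close>

text \<open>The two inequalities hold for any ranking of the centers, so \<open>\<le>\<close> on
  vertex numbers is taken because a machine can produce it. What needs real computation is the
  bipartition, which the input code does not contain. A fixed machine has no indices or counters:
  vertex numbers exist only as head positions, and loops over vertices are sweeps along a tape up to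
  a blank, hence the insistence on nonzero cells. Rounds and phases are run a fixed number of times,
  without a test for completion, which gives the running time a closed form in \<open>n\<close>. The
  numbers suffice because a round that adds no vertex leaves a union of components coloured, and
  each phase colours a new vertex while one is left. Unit capacities make an assignment injective,
  hence a matching. The shared ranking makes the centers of two different agents comparable: a
  center that is better for the later agent is also better in the eyes of the earlier one.\<close>

datatype prog =
    Op nat "(nat \<Rightarrow> nat) \<Rightarrow> nat" int
  | Seq prog prog  (infixr ";;" 60)
  | Cond "(nat \<Rightarrow> nat) \<Rightarrow> bool" prog prog
  | Loop "(nat \<Rightarrow> nat) \<Rightarrow> bool" prog

type_synonym store = "nat \<Rightarrow> tape"

text \<open>Tapes from \<open>k\<close> on read as blank, so that guards and written symbols depend
  only on what a machine with \<open>k\<close> tapes can scan.\<close>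

definition reads :: "nat \<Rightarrow> store \<Rightarrow> nat \<Rightarrow> nat" where
  "reads k s i = (if i < k then scan (s i) else 0)"

text \<open>The control is an explicit stack of programs still to be run, and unfolding a
  \<open>;;\<close>, \<open>Cond\<close> or \<open>Loop\<close> costs a step of its own; each step
  can thus be matched by a single machine step.\<close>

fun cstep :: "nat \<Rightarrow> prog list \<times> store \<Rightarrow> prog list \<times> store" where
  "cstep k ([], s) = ([], s)"
| "cstep k (Op i g d # K, s) = (K, s(i := act (g (reads k s), d) (s i)))"
| "cstep k ((p ;; q) # K, s) = (p # q # K, s)"
| "cstep k (Cond b p q # K, s) = ((if b (reads k s) then p else q) # K, s)"
| "cstep k (Loop b p # K, s) = (if b (reads k s) then p # Loop b p # K else K, s)"

primrec wf_prog :: "nat \<Rightarrow> nat \<Rightarrow> prog \<Rightarrow> bool" where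
  "wf_prog k m (Op i g d) \<longleftrightarrow> i < k \<and> d \<in> {-1, 0, 1} \<and> (\<forall>\<sigma>. (\<forall>j. \<sigma> j < m) \<longrightarrow> g \<sigma> < m)"
| "wf_prog k m (p ;; q) \<longleftrightarrow> wf_prog k m p \<and> wf_prog k m q"
| "wf_prog k m (Cond b p q) \<longleftrightarrow> wf_prog k m p \<and> wf_prog k m q"
| "wf_prog k m (Loop b p) \<longleftrightarrow> wf_prog k m p"

text \<open>The continuations reachable from \<open>p # K\<close>; they become the states of the Turing machine.\<close>

primrec conts :: "prog \<Rightarrow> prog list \<Rightarrow> prog list set" where
  "conts (Op i g d) K = {Op i g d # K}"
| "conts (p ;; q) K = insert ((p ;; q) # K) (conts p (q # K) \<union> conts q K)"
| "conts (Cond b p q) K = insert (Cond b p q # K) (conts p K \<union> conts q K)"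
| "conts (Loop b p) K = insert (Loop b p # K) (conts p (Loop b p # K))"

lemma finite_conts: "finite (conts p K)"
  by (induction p arbitrary: K) auto

lemma conts_refl: "p # K \<in> conts p K"
  by (cases p) auto

text \<open>A step inside a subprogram either stays among its continuations or drops to the stack
  beneath it, which is itself a continuation of the enclosing program. With \<open>K = []\<close>
  the only exit is the halting state.\<close>

lemma conts_closed: "c \<in> conts p K \<Longrightarrow> fst (cstep k (c, s)) \<in> insert K (conts p K)"
proof (induction p arbitrary: K)
  case (Seq p q)
  from Seq.prems consider "c = (p ;; q) # K" | "c \<in> conts p (q # K)" | "c \<in> conts q K"
    by auto
  then show ?case
  proof cases
    case 1
    then show ?thesis using conts_refl[of p "q # K"] by simp
  next
    case 2
    from Seq.IH(1)[OF this] show ?thesis using conts_refl[of q K] by auto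
  next
    case 3
    from Seq.IH(2)[OF this] show ?thesis by auto
  qed
next
  case (Cond b p q)
  from Cond.prems consider "c = Cond b p q # K" | "c \<in> conts p K" | "c \<in> conts q K"
    by auto
  then show ?case
  proof cases
    case 1
    then show ?thesis using conts_refl[of p K] conts_refl[of q K] by simp
  next
    case 2
    from Cond.IH(1)[OF this] show ?thesis by auto
  next
    case 3
    from Cond.IH(2)[OF this] show ?thesis by auto
  qed
next
  case (Loop b p)
  from Loop.prems consider "c = Loop b p # K" | "c \<in> conts p (Loop b p # K)"
    by auto
  then show ?case
  proof cases
    case 1
    then show ?thesis using conts_refl[of p "Loop b p # K"] by simp
  next
    case 2
    from Loop.IH[OF this] show ?thesis by auto
  qed
qed auto

lemma wf_conts:
  assumes "c \<in> conts p K" "wf_prog k m p" "\<forall>q\<in>set K. wf_prog k m q"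
  shows "\<forall>q\<in>set c. wf_prog k m q"
proof -
  define W where "W = {c. \<forall>q\<in>set c. wf_prog k m q}"
  have W: "q # K \<in> W \<longleftrightarrow> wf_prog k m q \<and> K \<in> W" for q K
    by (simp add: W_def)
  have "wf_prog k m p \<longrightarrow> K \<in> W \<longrightarrow> conts p K \<subseteq> W"
    by (induction p arbitrary: K) (simp_all add: W)
  then show ?thesis using assms by (auto simp: W_def)
qed

text \<open>The number of steps is chosen before \<open>K\<close>, so a run can be spliced in front
  of any continuation.\<close>

definition runs :: "nat \<Rightarrow> prog \<Rightarrow> store \<Rightarrow> nat \<Rightarrow> store \<Rightarrow> bool" where
  "runs k p s N s' \<longleftrightarrow> (\<exists>t\<le>N. \<forall>K. (cstep k ^^ t) (p # K, s) = (K, s'))"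

definition init_store :: "bool list \<Rightarrow> store" where
  "init_store w = (\<lambda>_. (word_tape [], 0))(0 := (word_tape w, 0))"

lemma cstep_halted: "(cstep k ^^ t) ([], s) = ([], s)"
  by (induction t) auto

lemma scan_act_eq: "act (scan t, 0) t = t"
  by (cases t) auto

lemma map2_act:
  "map2 act (map (\<lambda>j. f j) [0..<k]) (map s [0..<k]) = map (\<lambda>j. act (f j) (s j)) [0..<k]"
  by (simp add: zip_map_map zip_same_conv_map)

text \<open>The numbered continuations serve as states, the empty one as halting state. Steps that
  change only the control rewrite the scanned symbols in place without moving, so program and
  machine run in lockstep.\<close>

lemma prog_to_tm:
  assumes wf: "wf_prog k m p" and k: "2 \<le> k" and m: "3 \<le> m"
  shows "\<exists>M. wf_tm M \<and> (\<forall>w N s' v. runs k p (init_store w) N s' \<longrightarrow> fst (s' 1) = word_tape v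
            \<longrightarrow> outputs_within M w N v)"
proof -
  define Q where "Q = insert [] (conts p [])"
  have finQ: "finite Q" by (simp add: Q_def finite_conts)
  then obtain e where e: "bij_betw e Q {0..<card Q}" using ex_bij_betw_finite_nat by blast
  define dec where "dec = inv_into Q e"
  have dec_e: "dec (e c) = c" if "c \<in> Q" for c
    using e that by (simp add: dec_def bij_betw_inv_into_left)
  have dec_Q: "dec q \<in> Q" if "q < card Q" for q
    using e that unfolding dec_def by (metis atLeastLessThan_iff bij_betw_def inv_into_into zero_le)
  have e_less: "e c < card Q" if "c \<in> Q" for c
    using e that by (auto dest: bij_betwE)
  have e_inj: "e c = e c' \<longleftrightarrow> c = c'" if "c \<in> Q" "c' \<in> Q" for c c'
    using e that by (auto simp: bij_betw_def inj_on_def)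
  define val where "val ss i = (if i < k then ss ! i else 0)" for ss :: "nat list" and i
  define keep where "keep ss = map (\<lambda>j. (val ss j, 0 :: int)) [0..<k]" for ss
  define trans where "trans c ss = (case c of [] \<Rightarrow> ([], keep ss)
     | r # K \<Rightarrow> (case r of
         Op i g d \<Rightarrow> (K, map (\<lambda>j. if j = i then (g (val ss), d) else (val ss j, 0)) [0..<k])
       | Seq p q \<Rightarrow> (p # q # K, keep ss)
       | Cond b p q \<Rightarrow> ((if b (val ss) then p else q) # K, keep ss)
       | Loop b p \<Rightarrow> (if b (val ss) then p # Loop b p # K else K, keep ss)))" for c ss
  define M where "M = \<lparr>num_tapes = k, num_symbols = m, num_states = card Q, start = e [p],
     halt = e [], delta = (\<lambda>q ss. map_prod e id (trans (dec q) ss))\<rparr>"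
  have QI: "[] \<in> Q" "[p] \<in> Q" using conts_refl[of p "[]"] by (auto simp: Q_def)
  have closed: "fst (cstep k (c, s)) \<in> Q" if "c \<in> Q" for c s
    using conts_closed[of c p "[]" k s] that by (auto simp: Q_def)
  have trans_fst: "fst (trans c (map scan (map s [0..<k]))) = fst (cstep k (c, s))" for c s
  proof -
    have "val (map scan (map s [0..<k])) = reads k s"
      by (auto simp: val_def reads_def)
    then show ?thesis
      by (cases "(k, c, s)" rule: cstep.cases) (auto simp: trans_def)
  qed
  have trans_snd: "map2 act (snd (trans c (map scan (map s [0..<k])))) (map s [0..<k])
      = map (snd (cstep k (c, s))) [0..<k]" for c s
  proof -
    have v: "val (map scan (map s [0..<k])) = reads k s"
      by (auto simp: val_def reads_def)
    show ?thesis
      by (cases "(k, c, s)" rule: cstep.cases)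
         (auto simp: trans_def v keep_def map2_act reads_def scan_act_eq simp del: map_map)
  qed
  have wfc: "\<forall>r\<in>set c. wf_prog k m r" if "c \<in> Q" for c
    using that wf wf_conts[of c p "[]" k m] by (auto simp: Q_def)
  have "wf_tm M"
    unfolding wf_tm_def
  proof (intro conjI allI impI)
    fix q ss assume A: "q < num_states M \<and> length ss = num_tapes M \<and> set ss \<subseteq> {..<num_symbols M}"
    then have q: "dec q \<in> Q" and len: "length ss = k" and ss: "\<And>i. i < k \<Longrightarrow> ss ! i < m"
      using dec_Q by (auto simp: M_def dest: nth_mem)
    have vm: "val ss j < m" for j using ss m by (auto simp: val_def)
    \<comment> \<open>\<open>conts_closed\<close> speaks of stores, \<open>wf_tm\<close> of symbol
      lists; this store scans exactly \<open>ss\<close> on its first \<open>k\<close> tapes.\<close>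
    define s :: store where "s = (\<lambda>i. (\<lambda>_. ss ! i, 0))"
    have sc: "map scan (map s [0..<k]) = ss"
      using len by (auto simp: s_def intro: nth_equalityI)
    have 1: "fst (trans (dec q) ss) \<in> Q"
      using trans_fst[of "dec q" s] closed[OF q, of s] unfolding sc by simp
    have 2: "length (snd (trans (dec q) ss)) = k \<and>
        set (snd (trans (dec q) ss)) \<subseteq> {..<m} \<times> {-1, 0, 1}"
    proof (cases "dec q")
      case Nil
      then show ?thesis using vm by (auto simp: trans_def keep_def)
    next
      case (Cons r K)
      have "wf_prog k m r" using wfc[OF q] Cons by simp
      then show ?thesis using vm Cons by (cases r) (auto simp: trans_def keep_def)
    qed
    show "case delta M q ss of (q', as) \<Rightarrow> q' < num_states M \<and> length as = num_tapes M \<and>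
           set as \<subseteq> {..<num_symbols M} \<times> {-1, 0, 1}"
      using 1 2 e_less by (auto simp: M_def map_prod_def split: prod.splits)
  qed (use k m QI e_less in \<open>auto simp: M_def\<close>)
  moreover have "outputs_within M w N v"
    if r: "runs k p (init_store w) N s'" and v: "fst (s' 1) = word_tape v" for w N s' v
  proof -
    have sim: "(step M ^^ t) (e c, map s [0..<k]) =
        map_prod e (\<lambda>s. map s [0..<k]) ((cstep k ^^ t) (c, s)) \<and> fst ((cstep k ^^ t) (c, s)) \<in> Q"
      if "c \<in> Q" for t c s
    proof (induction t)
      case 0
      then show ?case using that by simp
    next
      case (Suc t)
      obtain c1 s1 where 1: "(cstep k ^^ t) (c, s) = (c1, s1)" by fastforce
      with Suc have c1: "c1 \<in> Q" by simp
      have "step M (e c1, map s1 [0..<k]) = map_prod e (\<lambda>s. map s [0..<k]) (cstep k (c1, s1))"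
      proof (cases "c1 = []")
        case True
        then show ?thesis by (simp add: M_def)
      next
        case False
        then have "e c1 \<noteq> halt M" using e_inj c1 QI by (simp add: M_def)
        then show ?thesis
          using trans_fst[of c1 s1] trans_snd[of c1 s1]
          by (simp add: M_def dec_e[OF c1] map_prod_def split_beta prod_eq_iff)
      qed
      then show ?case using Suc 1 closed[OF c1] by simp
    qed
    obtain t where t: "t \<le> N" "(cstep k ^^ t) ([p], init_store w) = ([], s')"
      using r by (auto simp: runs_def)
    \<comment> \<open>\<open>outputs_within\<close> fixes the number of steps exactly; since a
      halted configuration is a fixed point, the shorter run is padded to \<open>N\<close>.\<close>
    have "(cstep k ^^ N) ([p], init_store w) = (cstep k ^^ (N - t)) ((cstep k ^^ t) ([p], init_store w))"
      using t(1) by (metis comp_apply funpow_add le_add_diff_inverse2)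
    then have N: "(cstep k ^^ N) ([p], init_store w) = ([], s')"
      by (simp add: t(2) cstep_halted)
    have "init_config M w = (e [p], map (init_store w) [0..<k])"
    proof -
      have "(word_tape w, 0) # replicate (k - 1) (word_tape [], 0) = map (init_store w) [0..<k]"
        using k by (intro nth_equalityI) (auto simp: init_store_def nth_Cons')
      then show ?thesis by (simp add: init_config_def M_def)
    qed
    then show ?thesis
      using sim[OF QI(2), of N "init_store w"] N v k
      by (simp add: outputs_within_def M_def)
  qed
  ultimately show ?thesis by blast
qed

section \<open>Composition rules for time-bounded runs\<close>

lemma runs_mono: "runs k p s N s' \<Longrightarrow> N \<le> N' \<Longrightarrow> runs k p s N' s'"
  unfolding runs_def by (meson le_trans)

lemma runs_Op: "runs k (Op i g d) s 1 (s(i := act (g (reads k s), d) (s i)))"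
  unfolding runs_def by (rule exI[of _ 1]) simp

lemma runs_trans_aux:
  assumes "(cstep k ^^ t) x = y" "(cstep k ^^ t') y = z"
  shows "(cstep k ^^ (t' + t)) x = z"
  using assms by (simp add: funpow_add)

lemma runs_Seq:
  assumes "runs k p s N s1" "runs k q s1 N' s2"
  shows "runs k (p ;; q) s (N + N' + 1) s2"
proof -
  obtain t where t: "t \<le> N" "\<And>K. (cstep k ^^ t) (p # K, s) = (K, s1)"
    using assms(1) by (auto simp: runs_def)
  obtain t' where t': "t' \<le> N'" "\<And>K. (cstep k ^^ t') (q # K, s1) = (K, s2)"
    using assms(2) by (auto simp: runs_def)
  have "(cstep k ^^ (t' + t + 1)) ((p ;; q) # K, s) = (K, s2)" for K
    by (rule runs_trans_aux[where y = "(p # q # K, s)"])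
       (auto intro: runs_trans_aux[where y = "(q # K, s1)"] simp: t t')
  then show ?thesis unfolding runs_def using t(1) t'(1) by (intro exI[of _ "t' + t + 1"]) auto
qed

lemma runs_Cond:
  assumes "runs k (if b (reads k s) then p else q) s N s'"
  shows "runs k (Cond b p q) s (N + 1) s'"
proof -
  obtain t where t: "t \<le> N" "\<And>K. (cstep k ^^ t) ((if b (reads k s) then p else q) # K, s) = (K, s')"
    using assms by (auto simp: runs_def)
  have "(cstep k ^^ (t + 1)) (Cond b p q # K, s) = (K, s')" for K
    by (rule runs_trans_aux[OF _ t(2)]) simp
  then show ?thesis unfolding runs_def using t(1) by (intro exI[of _ "t + 1"]) auto
qed

text \<open>\<open>S j\<close> is the store before iteration \<open>j\<close>, so the family acts as
  invariant and iteration counter at once. Every iteration pays one step for its guard, and the exit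
  pays one more.\<close>

lemma runs_Loop:
  assumes "\<And>j. j < n \<Longrightarrow> b (reads k (S j))" "\<not> b (reads k (S n))"
    and "\<And>j. j < n \<Longrightarrow> runs k p (S j) B (S (Suc j))"
  shows "runs k (Loop b p) (S 0) (n * (B + 1) + 1) (S n)"
  using assms
proof (induction n arbitrary: S)
  case 0
  then show ?case unfolding runs_def by (intro exI[of _ 1]) auto
next
  case (Suc n)
  have "runs k (Loop b p) (S (Suc 0)) (n * (B + 1) + 1) (S (Suc n))"
    using Suc.IH[of "\<lambda>j. S (Suc j)"] Suc.prems by auto
  then obtain t' where t': "t' \<le> n * (B + 1) + 1"
    "\<And>K. (cstep k ^^ t') (Loop b p # K, S (Suc 0)) = (K, S (Suc n))"
    by (auto simp: runs_def)
  obtain t where t: "t \<le> B" "\<And>K. (cstep k ^^ t) (p # K, S 0) = (K, S (Suc 0))"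
    using Suc.prems(3)[of 0] by (auto simp: runs_def)
  have "(cstep k ^^ (t' + t + 1)) (Loop b p # K, S 0) = (K, S (Suc n))" for K
    by (rule runs_trans_aux[where y = "(p # Loop b p # K, S 0)"])
       (use Suc.prems(1)[of 0] in \<open>auto intro: runs_trans_aux[where y = "(Loop b p # K, S (Suc 0))"] simp: t t'\<close>)
  then show ?case unfolding runs_def using t(1) t'(1) by (intro exI[of _ "t' + t + 1"]) auto
qed

section \<open>Symbolic execution of straight-line code\<close>

primrec loop_free :: "prog \<Rightarrow> bool" where
  "loop_free (Op i g d) \<longleftrightarrow> True"
| "loop_free (p ;; q) \<longleftrightarrow> loop_free p \<and> loop_free q"
| "loop_free (Cond b p q) \<longleftrightarrow> loop_free p \<and> loop_free q"
| "loop_free (Loop b p) \<longleftrightarrow> False"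

primrec effect :: "nat \<Rightarrow> prog \<Rightarrow> store \<Rightarrow> store" where
  "effect k (Op i g d) s = s(i := act (g (reads k s), d) (s i))"
| "effect k (p ;; q) s = effect k q (effect k p s)"
| "effect k (Cond b p q) s = (if b (reads k s) then effect k p s else effect k q s)"
| "effect k (Loop b p) s = s"

text \<open>Charging both branches of \<open>Cond\<close> keeps the bound independent of the store.
  The value for \<open>Loop\<close> is a placeholder.\<close>

primrec cost :: "prog \<Rightarrow> nat" where
  "cost (Op i g d) = 1"
| "cost (p ;; q) = cost p + cost q + 1"
| "cost (Cond b p q) = cost p + cost q + 1"
| "cost (Loop b p) = 0"

lemma runs_loop_free: "loop_free p \<Longrightarrow> runs k p s (cost p) (effect k p s)"
proof (induction p arbitrary: s)
  case (Op i g d)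
  show ?case unfolding effect.simps cost.simps by (rule runs_Op)
next
  case (Seq p q)
  then show ?case unfolding effect.simps cost.simps loop_free.simps by (blast intro: runs_Seq)
next
  case (Cond b p q)
  have "runs k (if b (reads k s) then p else q) s (cost p + cost q) (effect k (Cond b p q) s)"
    using Cond.IH[of s] Cond.prems by (auto intro: runs_mono[of k p] runs_mono[of k q])
  then show ?case unfolding cost.simps by (rule runs_Cond)
qed simp

section \<open>Arrays on tapes\<close>

text \<open>Only the values of \<open>f\<close> below \<open>n\<close> reach the tape. The
  surrounding blanks are the sole end markers, so arrays that are traversed hold nonzero values. The
  offset \<open>b\<close> serves the matrix, which lies behind the erased unary prefix of the
  input.\<close>

definition arr :: "int \<Rightarrow> nat \<Rightarrow> (nat \<Rightarrow> nat) \<Rightarrow> nat \<Rightarrow> tape" where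
  "arr b n f p = (\<lambda>i. if b \<le> i \<and> i < b + int n then f (nat (i - b)) else 0, b + int p)"

lemma scan_arr: "j < n \<Longrightarrow> scan (arr b n f j) = f j"
  by (simp add: arr_def)

lemma scan_arr_end: "scan (arr b n f n) = 0"
  by (simp add: arr_def)

lemma arr_cong: "(\<And>i. i < n \<Longrightarrow> f i = g i) \<Longrightarrow> arr b n f p = arr b n g p"
  by (auto simp: arr_def fun_eq_iff)

lemma act_arr:
  assumes "j < n"
  shows "act (x, 0) (arr b n f j) = arr b n (f(j := x)) j"
    and "act (x, 1) (arr b n f j) = arr b n (f(j := x)) (Suc j)"
  using assms by (auto simp: arr_def fun_eq_iff)

lemma act_arr_append: "act (x, 1) (arr b j f j) = arr b (Suc j) (f(j := x)) (Suc j)"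
  by (auto simp: arr_def fun_eq_iff)

definition goR :: "nat \<Rightarrow> prog" where "goR i = Op i (\<lambda>\<sigma>. \<sigma> i) 1"

text \<open>After a full sweep the head stands on the blank behind the array, where the loop would
  stop at once; hence the initial move. The loop halts on the blank in front of the array, and the
  last move returns to the first cell.\<close>

definition rewind :: "nat \<Rightarrow> prog" where
  "rewind i = Op i (\<lambda>\<sigma>. \<sigma> i) (-1) ;; Loop (\<lambda>\<sigma>. \<sigma> i \<noteq> 0) (Op i (\<lambda>\<sigma>. \<sigma> i) (-1)) ;; goR i"

definition For :: "nat \<Rightarrow> prog \<Rightarrow> prog" where
  "For i p = Loop (\<lambda>\<sigma>. \<sigma> i \<noteq> 0) (p ;; goR i) ;; rewind i"

text \<open>Per cell, 3 steps of loop and sequencing overhead plus 2 for the rewind; the remaining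
  costs add up to 7, rounded up to 10.\<close>

definition for_cost :: "nat \<Rightarrow> nat \<Rightarrow> nat" where
  "for_cost n c = n * (c + 5) + 10"

lemma runs_Op_move:
  assumes "i < k" "s i = (t, h)" "s' = s(i := (t, h + d))"
  shows "runs k (Op i (\<lambda>\<sigma>. \<sigma> i) d) s 1 s'"
  using runs_Op[of k i "\<lambda>\<sigma>. \<sigma> i" d s] assms by (simp add: reads_def fun_upd_idem)

lemma rewind_runs:
  assumes i: "i < k" and s: "s i = arr b n f p" and "p \<le> n" and nz: "\<And>j. j < n \<Longrightarrow> f j \<noteq> 0"
  shows "runs k (rewind i) s (2 * n + 5) (s(i := arr b n f 0))"
proof -
  obtain t where t: "\<And>p. arr b n f p = (t, b + int p)"
    by (simp add: arr_def)
  \<comment> \<open>The head after the first move and \<open>j\<close> iterations; for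
    \<open>j = p\<close> it is on the blank just before the array.\<close>
  define S where "S j = s(i := (t, b + int p - 1 - int j))" for j
  have rd: "reads k (S j) i = (if j < p then f (p - 1 - j) else 0)" if "j \<le> p" for j
  proof -
    have "reads k (S j) i = t (b + int p - 1 - int j)"
      using i by (simp add: reads_def S_def)
    moreover have "t = fst (arr b n f 0)" by (simp add: t)
    ultimately show ?thesis using that \<open>p \<le> n\<close>
      by (auto simp: arr_def nat_diff_distrib intro!: arg_cong[of _ _ f])
  qed
  have 1: "runs k (Op i (\<lambda>\<sigma>. \<sigma> i) (-1)) s 1 (S 0)"
    by (rule runs_Op_move[where s = s, OF i]) (auto simp: S_def s t)
  have 2: "runs k (Loop (\<lambda>\<sigma>. \<sigma> i \<noteq> 0) (Op i (\<lambda>\<sigma>. \<sigma> i) (-1))) (S 0) (p * (1 + 1) + 1) (S p)"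
  proof (rule runs_Loop)
    fix j assume "j < p"
    then show "reads k (S j) i \<noteq> 0" using nz \<open>p \<le> n\<close> by (simp add: rd)
    show "runs k (Op i (\<lambda>\<sigma>. \<sigma> i) (-1)) (S j) 1 (S (Suc j))"
      by (rule runs_Op_move[OF i]) (auto simp: S_def)
  qed (simp add: rd)
  have 3: "runs k (goR i) (S p) 1 (s(i := arr b n f 0))"
    unfolding goR_def by (rule runs_Op_move[OF i]) (auto simp: S_def t)
  show ?thesis
    unfolding rewind_def using \<open>p \<le> n\<close>
    by (intro runs_mono[OF runs_Seq[OF 1 runs_Seq[OF 2 3]]]) simp
qed

text \<open>The body runs with the head of tape \<open>i\<close> on cell \<open>j\<close> and may overwrite that cell.\<close>

lemma For_runs:
  assumes i: "i < k"
    and body: "\<And>j. j < n \<Longrightarrow>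
      runs k p ((S j)(i := arr b n (f j) j)) c ((S (Suc j))(i := arr b n (f (Suc j)) j))"
    and nz: "\<And>j l. l < n \<Longrightarrow> j \<le> n \<Longrightarrow> f j l \<noteq> 0"
  shows "runs k (For i p) ((S 0)(i := arr b n (f 0) 0)) (for_cost n c) ((S n)(i := arr b n (f n) 0))"
proof -
  define T where "T j = (S j)(i := arr b n (f j) j)" for j
  have 1: "runs k (Loop (\<lambda>\<sigma>. \<sigma> i \<noteq> 0) (p ;; goR i)) (T 0) (n * (c + 1 + 1 + 1) + 1) (T n)"
  proof (rule runs_Loop)
    fix j assume j: "j < n"
    then show "reads k (T j) i \<noteq> 0" using i nz by (simp add: reads_def T_def scan_arr)
    have "runs k (goR i) ((S (Suc j))(i := arr b n (f (Suc j)) j)) 1 (T (Suc j))"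
      unfolding goR_def by (rule runs_Op_move[OF i]) (auto simp: arr_def T_def)
    with body[OF j] show "runs k (p ;; goR i) (T j) (c + 1 + 1) (T (Suc j))"
      unfolding T_def by (rule runs_Seq)
  qed (use i in \<open>simp add: reads_def T_def scan_arr_end\<close>)
  have 2: "runs k (rewind i) (T n) (2 * n + 5) ((T n)(i := arr b n (f n) 0))"
    by (rule rewind_runs[OF i]) (auto simp: T_def nz)
  show ?thesis
    unfolding For_def using runs_Seq[OF 1 2]
    by (auto simp: T_def for_cost_def algebra_simps elim: runs_mono)
qed

lemma runs_loop_freeI:
  "loop_free p \<Longrightarrow> cost p \<le> N \<Longrightarrow> effect k p s = s' \<Longrightarrow> runs k p s N s'"
  using runs_loop_free runs_mono by blast

definition advance :: "tape \<Rightarrow> tape" where "advance t = (fst t, snd t + 1)"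

lemma advance_arr: "advance (arr b n f p) = arr b n f (Suc p)"
  by (simp add: advance_def arr_def)

lemma goR_simps [simp]:
  "loop_free (goR i)" "cost (goR i) = 1"
  "i < k \<Longrightarrow> effect k (goR i) s = s(i := advance (s i))"
  by (cases "s i"; simp add: goR_def reads_def advance_def)+

definition bitsym :: "bool \<Rightarrow> nat" where "bitsym c = (if c then 2 else 1)"

lemma bitsym_eq_1: "bitsym c = Suc 0 \<longleftrightarrow> \<not> c"
  by (simp add: bitsym_def)

lemma bitsym_True: "bitsym True = 2"
  by (simp add: bitsym_def)

definition out :: "bool list \<Rightarrow> tape" where "out v = (word_tape v, int (length v))"

lemma act_out: "act (bitsym c, 1) (out v) = out (v @ [c])"
  by (auto simp: out_def bitsym_def word_tape_def fun_eq_iff nth_append)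

lemma bitsym_neq_0: "bitsym c \<noteq> 0"
  by (simp add: bitsym_def)

lemma bitsym_eq_2: "bitsym c = 2 \<longleftrightarrow> c"
  by (simp add: bitsym_def)

text \<open>Positional tapes turn each update into a rewrite of one argument, so the simplifier can
  execute straight-line code. Tape 0 holds the matrix, 1 the output, 2 and 3 the colours, 4 and 5
  unary counters of length \<open>n\<close>; tapes 3 and 4 later become scratch space.\<close>

definition store6 :: "tape \<Rightarrow> tape \<Rightarrow> tape \<Rightarrow> tape \<Rightarrow> tape \<Rightarrow> tape \<Rightarrow> store" where
  "store6 t0 t1 t2 t3 t4 t5 =
     (\<lambda>_. (word_tape [], 0))(0 := t0, 1 := t1, 2 := t2, 3 := t3, 4 := t4, 5 := t5)"

lemma store6_simps [simp]:
  "store6 t0 t1 t2 t3 t4 t5 0 = t0" "store6 t0 t1 t2 t3 t4 t5 (Suc 0) = t1"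
  "store6 t0 t1 t2 t3 t4 t5 2 = t2" "store6 t0 t1 t2 t3 t4 t5 3 = t3"
  "store6 t0 t1 t2 t3 t4 t5 4 = t4" "store6 t0 t1 t2 t3 t4 t5 5 = t5"
  "(store6 t0 t1 t2 t3 t4 t5)(0 := x) = store6 x t1 t2 t3 t4 t5"
  "(store6 t0 t1 t2 t3 t4 t5)(Suc 0 := x) = store6 t0 x t2 t3 t4 t5"
  "(store6 t0 t1 t2 t3 t4 t5)(2 := x) = store6 t0 t1 x t3 t4 t5"
  "(store6 t0 t1 t2 t3 t4 t5)(3 := x) = store6 t0 t1 t2 x t4 t5"
  "(store6 t0 t1 t2 t3 t4 t5)(4 := x) = store6 t0 t1 t2 t3 x t5"
  "(store6 t0 t1 t2 t3 t4 t5)(5 := x) = store6 t0 t1 t2 t3 t4 x"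
  by (simp_all add: store6_def fun_upd_twist)

lemma reads_store6 [simp]:
  "reads 6 (store6 t0 t1 t2 t3 t4 t5) 0 = scan t0"
  "reads 6 (store6 t0 t1 t2 t3 t4 t5) (Suc 0) = scan t1"
  "reads 6 (store6 t0 t1 t2 t3 t4 t5) 2 = scan t2"
  "reads 6 (store6 t0 t1 t2 t3 t4 t5) 3 = scan t3"
  "reads 6 (store6 t0 t1 t2 t3 t4 t5) 4 = scan t4"
  "reads 6 (store6 t0 t1 t2 t3 t4 t5) 5 = scan t5"
  by (simp_all add: reads_def)

section \<open>Computing the colouring\<close>

text \<open>Colour \<open>1\<close> means uncoloured, \<open>2\<close> agent, \<open>3\<close> center. The colour \<open>0\<close> is avoided because it is the
  blank that delimits arrays on tapes. A coloured neighbour overwrites unconditionally: if the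
  colouring so far extends to a proper one, this does not change vertices that have a colour.\<close>

fun relax :: "(nat \<Rightarrow> nat \<Rightarrow> bool) \<Rightarrow> (nat \<Rightarrow> nat) \<Rightarrow> nat \<Rightarrow> nat \<Rightarrow> nat" where
  "relax E c 0 v = c v"
| "relax E c (Suc u) v = (if E u v \<and> (c u = 2 \<or> c u = 3) then 5 - c u else relax E c u v)"

text \<open>No bound \<open>n\<close> is mentioned: once all vertices below \<open>n\<close> have
  colours, a change can only occur at or above \<open>n\<close>, outside the arrays and outside
  \<open>settled n\<close>.\<close>

definition seed :: "(nat \<Rightarrow> nat) \<Rightarrow> nat \<Rightarrow> nat" where
  "seed c v = (if c v = 1 \<and> (\<forall>i<v. c i \<noteq> 1) then 2 else c v)"

definition colouring :: "nat \<Rightarrow> (nat \<Rightarrow> nat \<Rightarrow> bool) \<Rightarrow> nat \<Rightarrow> nat" where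
  "colouring n E = ((\<lambda>c. ((\<lambda>c. relax E c n) ^^ n) (seed c)) ^^ n) (\<lambda>_. 1)"

definition coloured :: "(nat \<Rightarrow> nat) \<Rightarrow> bool" where
  "coloured c \<longleftrightarrow> (\<forall>v. c v \<in> {1, 2, 3})"

lemma coloured_relax: "coloured c \<Longrightarrow> coloured (relax E c u)"
proof (induction u)
  case 0
  then show ?case by (simp add: coloured_def)
next
  case (Suc u)
  then show ?case by (auto simp: coloured_def)
qed

lemma coloured_seed: "coloured c \<Longrightarrow> coloured (seed c)"
  by (auto simp: coloured_def seed_def)

lemma coloured_rounds: "coloured c \<Longrightarrow> coloured (((\<lambda>c. relax E c n) ^^ m) c)"
  by (induction m) (auto intro: coloured_relax)

lemma coloured_phases:
  "coloured c \<Longrightarrow> coloured (((\<lambda>c. ((\<lambda>c. relax E c n) ^^ n) (seed c)) ^^ m) c)"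
  by (induction m) (auto intro: coloured_rounds coloured_seed)

lemma coloured_colouring: "coloured (colouring n E)"
  unfolding colouring_def by (rule coloured_phases) (simp add: coloured_def)

lemma coloured_neq_0: "coloured c \<Longrightarrow> c v \<noteq> 0"
  by (metis coloured_def insertE singletonD zero_neq_numeral zero_neq_one)

text \<open>Tape \<open>2\<close> is read at the row index and tape \<open>3\<close> at the column index of the adjacency matrix
  on tape \<open>0\<close>; tape \<open>3\<close> receives the new colours and is copied back.\<close>

definition relax_prog :: prog where
  "relax_prog = For 2 (For 3
     (Op 3 (\<lambda>\<sigma>. if \<sigma> 0 = 2 \<and> (\<sigma> 2 = 2 \<or> \<sigma> 2 = 3) then 5 - \<sigma> 2 else \<sigma> 3) 0 ;; goR 0)) ;;
   rewind 0 ;; For 3 (Op 2 (\<lambda>\<sigma>. \<sigma> 3) 1) ;; rewind 2"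

text \<open>The current cell of the loop tape \<open>4\<close> records whether an uncoloured vertex has been met.\<close>

definition seed_prog :: prog where
  "seed_prog = For 2
     (Cond (\<lambda>\<sigma>. \<sigma> 2 = 1 \<and> \<sigma> 4 = 1) (Op 2 (\<lambda>_. 2) 0 ;; Op 4 (\<lambda>_. 2) 0) (Op 2 (\<lambda>\<sigma>. \<sigma> 2) 0) ;;
      Op 3 (\<lambda>\<sigma>. \<sigma> 2) 1) ;;
   rewind 3 ;; Op 4 (\<lambda>_. 1) 0"

text \<open>Tapes 4 and 5 carry \<open>n\<close> nonzero cells each and act as the counters of the
  phases and of the rounds within a phase.\<close>

definition colour_prog :: prog where
  "colour_prog = For 4 (seed_prog ;; For 5 relax_prog)"

section \<open>Programs that write the blocks of the output and set up the tapes\<close>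

definition adj_prog :: prog where
  "adj_prog = For 2 (Op 1 (\<lambda>\<sigma>. bitsym (\<sigma> 2 = 2)) 1) ;;
   For 2 (For 3 (Op 1 (\<lambda>\<sigma>. bitsym (\<sigma> 2 = 2 \<and> \<sigma> 0 = 2)) 1 ;; goR 0)) ;; rewind 0"

definition skip :: prog where "skip = Op 0 (\<lambda>\<sigma>. \<sigma> 0) 0"

definition emit :: "bool \<Rightarrow> prog" where "emit c = Op 1 (\<lambda>_. bitsym c) 1"

text \<open>The four bits are the code of capacity 1: sign, digit marker, the digit, end
  marker.\<close>

definition cap_prog :: prog where
  "cap_prog = For 2 (Cond (\<lambda>\<sigma>. \<sigma> 2 = 2) skip
     (emit False ;; emit True ;; emit True ;; emit False))"

text \<open>A preference matrix scans the same adjacency row \<open>n\<close> times while the head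
  of tape 0 moves on, so the row is first copied to tape 4. Resetting tape 3 to 1 removes what the
  previous vertex left there.\<close>

definition copy_prog :: prog where
  "copy_prog = For 3 (Op 4 (\<lambda>\<sigma>. \<sigma> 0) 1 ;; Op 3 (\<lambda>_. 1) 0 ;; goR 0) ;; rewind 4"

text \<open>The order test \<open>x \<le> y\<close> needs no index comparison: cells of tape \<open>4\<close> below \<open>x\<close> carry the
  mark \<open>3\<close>, and the cell of tape \<open>3\<close> at \<open>x\<close> stays \<open>1\<close> until position \<open>x\<close> of tape \<open>4\<close> is reached,
  whose content (plus one) it then remembers.\<close>

definition row_prog :: prog where
  "row_prog = For 3 (For 4 (Cond (\<lambda>\<sigma>. \<sigma> 4 \<noteq> 3 \<and> \<sigma> 3 = 1)
     (Op 1 (\<lambda>\<sigma>. bitsym (\<sigma> 4 = 2)) 1 ;; Op 3 (\<lambda>\<sigma>. if \<sigma> 4 = 2 then 3 else 2) 0 ;; Op 4 (\<lambda>_. 3) 0)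
     (Op 1 (\<lambda>\<sigma>. bitsym (\<sigma> 3 = 3 \<and> \<sigma> 4 = 2)) 1)))"

text \<open>Rows of centers are copied as well, to carry the head of tape 0 on to the next
  row.\<close>

definition pref_prog :: prog where
  "pref_prog = For 2 (copy_prog ;; Cond (\<lambda>\<sigma>. \<sigma> 2 = 2) row_prog skip)"

text \<open>The unary prefix of the input is erased, so that the blank in front of the matrix stops
  later rewinds of tape \<open>0\<close>.\<close>

definition init_prog :: prog where
  "init_prog = Loop (\<lambda>\<sigma>. \<sigma> 0 = 2)
     (emit True ;; Op 2 (\<lambda>_. 1) 1 ;; Op 3 (\<lambda>_. 1) 1 ;; Op 4 (\<lambda>_. 1) 1 ;; Op 5 (\<lambda>_. 1) 1 ;;
      Op 0 (\<lambda>_. 0) 1) ;;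
   emit False ;; Op 0 (\<lambda>_. 0) 1 ;; rewind 2 ;; rewind 3 ;; rewind 4 ;; rewind 5"

definition red_prog :: prog where
  "red_prog = init_prog ;; colour_prog ;; adj_prog ;; cap_prog ;; pref_prog"

text \<open>Four symbols suffice: the blank, the two bits, and 3 as colour or mark. The value
  \<open>5 - \<sigma> 2\<close> stays in range because its guard restricts \<open>\<sigma> 2\<close>
  to 2 or 3.\<close>

lemma wf_red_prog: "wf_prog 6 4 red_prog"
  by (auto simp: red_prog_def init_prog_def colour_prog_def adj_prog_def cap_prog_def pref_prog_def
      seed_prog_def relax_prog_def row_prog_def copy_prog_def skip_def emit_def For_def rewind_def
      goR_def bitsym_def)

text \<open>Row-major adjacency matrix. It starts at cell \<open>Suc n\<close> because the unary
  prefix occupies \<open>n\<close> cells and its terminator one.\<close>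

definition mat :: "nat \<Rightarrow> (nat \<Rightarrow> nat \<Rightarrow> bool) \<Rightarrow> nat \<Rightarrow> tape" where
  "mat n E p = arr (int (Suc n)) (n * n) (\<lambda>i. bitsym (E (i div n) (i mod n))) p"

lemma scan_mat:
  assumes "u < n" "v < n"
  shows "scan (mat n E (u * n + v)) = bitsym (E u v)"
proof -
  have "u * n + v < Suc u * n" using assms by simp
  also have "\<dots> \<le> n * n" using assms by (intro mult_le_mono1) simp
  finally show ?thesis using assms by (simp add: mat_def scan_arr)
qed

lemma advance_mat: "advance (mat n E p) = mat n E (Suc p)"
  by (simp add: mat_def advance_arr)

lemma rewind_mat:
  "runs 6 (rewind 0) (store6 (mat n E (n * n)) t1 t2 t3 t4 t5) (2 * (n * n) + 5)
     (store6 (mat n E 0) t1 t2 t3 t4 t5)"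
  using rewind_runs[of 0 6 "store6 (mat n E (n * n)) t1 t2 t3 t4 t5" "int (Suc n)" "n * n"
      "\<lambda>i. bitsym (E (i div n) (i mod n))" "n * n"]
  by (simp add: mat_def bitsym_neq_0)

lemma relax_row_runs:
  assumes u: "u < n" and c: "coloured c"
  shows "runs 6 (For 3
      (Op 3 (\<lambda>\<sigma>. if \<sigma> 0 = 2 \<and> (\<sigma> 2 = 2 \<or> \<sigma> 2 = 3) then 5 - \<sigma> 2 else \<sigma> 3) 0 ;; goR 0))
     (store6 (mat n E (u * n)) t1 (arr 0 n c u) (arr 0 n (relax E c u) 0) t4 t5)
     (for_cost n 3)
     (store6 (mat n E (Suc u * n)) t1 (arr 0 n c u) (arr 0 n (relax E c (Suc u)) 0) t4 t5)"
proof -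
  \<comment> \<open>Tape 3 in the middle of row \<open>u\<close>: the first \<open>j\<close> cells
    have already taken this row into account. Tape 2 keeps the old colours during the whole round,
    as \<open>relax\<close> demands.\<close>
  define f where "f j v = (if v < j then relax E c (Suc u) v else relax E c u v)" for j v
  have cf: "coloured (f j)" for j
    using coloured_relax[OF c, of E u] coloured_relax[OF c, of E "Suc u"]
    by (simp add: coloured_def f_def)
  have "runs 6 (For 3
      (Op 3 (\<lambda>\<sigma>. if \<sigma> 0 = 2 \<and> (\<sigma> 2 = 2 \<or> \<sigma> 2 = 3) then 5 - \<sigma> 2 else \<sigma> 3) 0 ;; goR 0))
     ((store6 (mat n E (u * n + 0)) t1 (arr 0 n c u) t3 t4 t5)(3 := arr 0 n (f 0) 0))
     (for_cost n 3)
     ((store6 (mat n E (u * n + n)) t1 (arr 0 n c u) t3 t4 t5)(3 := arr 0 n (f n) 0))" for t3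
  proof (rule For_runs, goal_cases)
    case (2 j)
    have "(f j)(j := if E u j \<and> (c u = 2 \<or> c u = 3) then 5 - c u else f j j) = f (Suc j)"
      by (auto simp: f_def fun_eq_iff less_Suc_eq)
    then show ?case
      using 2 u
      by (intro runs_loop_freeI)
         (simp_all add: scan_mat advance_mat scan_arr act_arr bitsym_eq_2 cong: if_cong)
  qed (use coloured_neq_0[OF cf] in auto)
  moreover have "f 0 = relax E c u" by (simp add: f_def fun_eq_iff)
  moreover have "arr 0 n (f n) 0 = arr 0 n (relax E c (Suc u)) 0"
    by (rule arr_cong) (simp add: f_def)
  ultimately show ?thesis by (simp add: add.commute)
qed

definition relax_cost :: "nat \<Rightarrow> nat" where
  "relax_cost n = for_cost n (for_cost n 3) + (2 * (n * n) + 5) + for_cost n 1 + (2 * n + 5) + 3"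

lemma relax_runs:
  assumes c: "coloured c"
  shows "runs 6 relax_prog (store6 (mat n E 0) t1 (arr 0 n c 0) (arr 0 n c 0) t4 t5) (relax_cost n)
    (store6 (mat n E 0) t1 (arr 0 n (relax E c n) 0) (arr 0 n (relax E c n) 0) t4 t5)"
proof -
  let ?r = "relax E c n"
  have nz: "c v \<noteq> 0" "?r v \<noteq> 0" for v
    using c coloured_relax coloured_neq_0 by blast+
  have c0: "relax E c 0 = c" by (simp add: fun_eq_iff)
  have 1: "runs 6 (For 2 (For 3
      (Op 3 (\<lambda>\<sigma>. if \<sigma> 0 = 2 \<and> (\<sigma> 2 = 2 \<or> \<sigma> 2 = 3) then 5 - \<sigma> 2 else \<sigma> 3) 0 ;; goR 0)))
     ((store6 (mat n E (0 * n)) t1 t2 (arr 0 n (relax E c 0) 0) t4 t5)(2 := arr 0 n c 0))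
     (for_cost n (for_cost n 3))
     ((store6 (mat n E (n * n)) t1 t2 (arr 0 n (relax E c n) 0) t4 t5)(2 := arr 0 n c 0))" for t2
    by (rule For_runs) (use relax_row_runs[OF _ c] nz in \<open>simp_all del: relax.simps\<close>)
  define g where "g j v = (if v < j then ?r v else c v)" for j v
  have 2: "runs 6 (For 3 (Op 2 (\<lambda>\<sigma>. \<sigma> 3) 1))
     ((store6 (mat n E 0) t1 (arr 0 n (g 0) 0) t3 t4 t5)(3 := arr 0 n ?r 0))
     (for_cost n 1)
     ((store6 (mat n E 0) t1 (arr 0 n (g n) n) t3 t4 t5)(3 := arr 0 n ?r 0))" for t3
  proof (rule For_runs, goal_cases)
    case (2 j)
    have "(g j)(j := ?r j) = g (Suc j)"
      by (auto simp: g_def fun_eq_iff less_Suc_eq)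
    then show ?case
      using 2 by (intro runs_loop_freeI) (simp_all add: scan_arr act_arr)
  qed (use nz in auto)
  have 3: "runs 6 (rewind 2) (store6 (mat n E 0) t1 (arr 0 n ?r n) t3 t4 t5) (2 * n + 5)
     (store6 (mat n E 0) t1 (arr 0 n ?r 0) t3 t4 t5)" for t3
    using rewind_runs[of 2 6 "store6 (mat n E 0) t1 (arr 0 n ?r n) t3 t4 t5" 0 n ?r n] nz by simp
  have g0: "g 0 = c" by (simp add: g_def fun_eq_iff)
  have gn: "arr 0 n (g n) n = arr 0 n ?r n" by (rule arr_cong) (simp add: g_def)
  show ?thesis
    unfolding relax_prog_def relax_cost_def
    by (rule runs_mono[OF runs_Seq[OF 1[simplified c0, simplified]
          runs_Seq[OF rewind_mat runs_Seq[OF 2[simplified g0 gn, simplified] 3]]]]) simp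
qed

definition seed_cost :: "nat \<Rightarrow> nat" where
  "seed_cost n = for_cost n 7 + (2 * n + 5) + 1 + 2"

lemma seed_runs:
  assumes c: "coloured c" and s: "s < n" and h: "h s = 1"
  shows "runs 6 seed_prog (store6 t0 t1 (arr 0 n c 0) (arr 0 n c 0) (arr 0 n h s) t5) (seed_cost n)
    (store6 t0 t1 (arr 0 n (seed c) 0) (arr 0 n (seed c) 0) (arr 0 n h s) t5)"
proof -
  define f where "f j v = (if v < j then seed c v else c v)" for j v
  \<comment> \<open>The marked cell of tape 4 holds \<open>bitsym (found j)\<close>; its initial
    content 1 is the code of \<open>False\<close>.\<close>
  define found where "found j \<longleftrightarrow> (\<exists>i<j. c i = 1)" for j
  have found: "found 0 = False" "found (Suc j) \<longleftrightarrow> found j \<or> c j = 1"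
    "seed c j = (if c j = 1 \<and> \<not> found j then 2 else c j)" for j
    by (auto simp: found_def seed_def less_Suc_eq)
  have nz: "f j v \<noteq> 0" "seed c v \<noteq> 0" for j v
    using coloured_neq_0[OF c] coloured_neq_0[OF coloured_seed[OF c]] by (auto simp: f_def)
  have 1: "runs 6 (For 2
     (Cond (\<lambda>\<sigma>. \<sigma> 2 = 1 \<and> \<sigma> 4 = 1) (Op 2 (\<lambda>_. 2) 0 ;; Op 4 (\<lambda>_. 2) 0) (Op 2 (\<lambda>\<sigma>. \<sigma> 2) 0) ;;
      Op 3 (\<lambda>\<sigma>. \<sigma> 2) 1))
     ((store6 t0 t1 t2 (arr 0 n (f 0) 0) (arr 0 n (h(s := bitsym (found 0))) s) t5)(2 := arr 0 n (f 0) 0))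
     (for_cost n 7)
     ((store6 t0 t1 t2 (arr 0 n (f n) n) (arr 0 n (h(s := bitsym (found n))) s) t5)(2 := arr 0 n (f n) 0))"
    for t2
  proof (rule For_runs, goal_cases)
    case (2 j)
    have fj: "f j j = c j" "f (Suc j) j = seed c j" by (simp_all add: f_def)
    have upd: "(f j)(j := seed c j) = f (Suc j)"
      by (auto simp: f_def fun_eq_iff less_Suc_eq)
    show ?case
    proof (cases "c j = 1 \<and> \<not> found j")
      case True
      then have "seed c j = 2" "found (Suc j)" by (simp_all add: found)
      then show ?thesis
        using 2 True upd s
        by (intro runs_loop_freeI) (simp_all add: scan_arr act_arr fj bitsym_eq_1 bitsym_True
            fun_upd_def[of "\<lambda>a. if a = s then bitsym False else h a"] cong: if_cong)
    next
      case False
      then have "seed c j = c j" "found (Suc j) = found j" by (auto simp: found)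
      then show ?thesis
        using 2 False upd s
        by (intro runs_loop_freeI) (auto simp add: scan_arr act_arr fj bitsym_eq_1)
    qed
  qed (use nz in auto)
  have f0: "f 0 = c" by (simp add: f_def fun_eq_iff)
  have fn: "arr 0 n (f n) p = arr 0 n (seed c) p" for p by (rule arr_cong) (simp add: f_def)
  have h0: "h(s := bitsym (found 0)) = h" using h by (auto simp: found bitsym_def)
  have 2: "runs 6 (rewind 3) (store6 t0 t1 t2 (arr 0 n (seed c) n) t4 t5) (2 * n + 5)
     (store6 t0 t1 t2 (arr 0 n (seed c) 0) t4 t5)" for t2 t4
    using rewind_runs[of 3 6 "store6 t0 t1 t2 (arr 0 n (seed c) n) t4 t5" 0 n "seed c" n] nz by simp
  \<comment> \<open>The marker is cleared so that the next phase again finds a counter consisting of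
    ones.\<close>
  have 3: "runs 6 (Op 4 (\<lambda>_. 1) 0) (store6 t0 t1 t2 t3 (arr 0 n (h(s := bitsym (found n))) s) t5) 1
     (store6 t0 t1 t2 t3 (arr 0 n h s) t5)" for t2 t3
    using s h by (intro runs_loop_freeI) (auto simp: act_arr fun_upd_idem)
  show ?thesis
    unfolding seed_prog_def seed_cost_def
    by (rule runs_mono[OF runs_Seq[OF 1[unfolded store6_simps f0 fn h0]
          runs_Seq[OF 2 3]]]) simp
qed

definition colour_cost :: "nat \<Rightarrow> nat" where
  "colour_cost n = for_cost n (seed_cost n + for_cost n (relax_cost n) + 1)"

lemma colour_runs:
  "runs 6 colour_prog
    (store6 (mat n E 0) t1 (arr 0 n (\<lambda>_. 1) 0) (arr 0 n (\<lambda>_. 1) 0) (arr 0 n (\<lambda>_. 1) 0) (arr 0 n (\<lambda>_. 1) 0))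
    (colour_cost n)
    (store6 (mat n E 0) t1 (arr 0 n (colouring n E) 0) (arr 0 n (colouring n E) 0)
       (arr 0 n (\<lambda>_. 1) 0) (arr 0 n (\<lambda>_. 1) 0))"
proof -
  let ?R = "\<lambda>c. relax E c n"
  define P where "P j = ((\<lambda>c. (?R ^^ n) (seed c)) ^^ j) (\<lambda>_. 1)" for j
  have P: "coloured (P j)" for j
    unfolding P_def by (rule coloured_phases) (simp add: coloured_def)
  have PSuc: "P (Suc j) = (?R ^^ n) (seed (P j))" for j by (simp add: P_def)
  have 1: "runs 6 (For 5 relax_prog)
      ((store6 (mat n E 0) t1 (arr 0 n ((?R ^^ 0) c) 0) (arr 0 n ((?R ^^ 0) c) 0) t4 t5)(5 := arr 0 n (\<lambda>_. 1) 0))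
      (for_cost n (relax_cost n))
      ((store6 (mat n E 0) t1 (arr 0 n ((?R ^^ n) c) 0) (arr 0 n ((?R ^^ n) c) 0) t4 t5)(5 := arr 0 n (\<lambda>_. 1) 0))"
    if "coloured c" for c t4 t5
    by (rule For_runs) (use relax_runs[OF coloured_rounds[OF that]] in simp_all)
  have "runs 6 (For 4 (seed_prog ;; For 5 relax_prog))
      ((store6 (mat n E 0) t1 (arr 0 n (P 0) 0) (arr 0 n (P 0) 0) t4 (arr 0 n (\<lambda>_. 1) 0))(4 := arr 0 n (\<lambda>_. 1) 0))
      (for_cost n (seed_cost n + for_cost n (relax_cost n) + 1))
      ((store6 (mat n E 0) t1 (arr 0 n (P n) 0) (arr 0 n (P n) 0) t4 (arr 0 n (\<lambda>_. 1) 0))(4 := arr 0 n (\<lambda>_. 1) 0))" for t4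
  proof (rule For_runs, goal_cases)
    case (2 j)
    have s: "coloured (seed (P j))" by (rule coloured_seed[OF P])
    show ?case
      unfolding store6_simps PSuc
      by (rule runs_Seq[OF seed_runs[OF P 2] 1[OF s, unfolded store6_simps funpow_0]]) simp
  qed simp_all
  then show ?thesis
    by (simp add: colour_prog_def colour_cost_def P_def colouring_def)
qed

section \<open>Writing the output\<close>

text \<open>In this and the next three codes, the last argument of the matrix and capacity blocks
  counts completed outer iterations: the full block is the case \<open>m = n\<close>, smaller
  \<open>m\<close> give the loop invariant.\<close>

definition arcs_code :: "nat \<Rightarrow> (nat \<Rightarrow> nat \<Rightarrow> bool) \<Rightarrow> (nat \<Rightarrow> nat) \<Rightarrow> nat \<Rightarrow> bool list" where
  "arcs_code n E c m = concat (map (\<lambda>u. map (\<lambda>v. c u = 2 \<and> E u v) [0..<n]) [0..<m])"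

definition caps_code :: "(nat \<Rightarrow> nat) \<Rightarrow> nat \<Rightarrow> bool list" where
  "caps_code c m = concat (map (\<lambda>l. if c l = 2 then [] else [False, True, True, False]) [0..<m])"

definition row_code :: "nat \<Rightarrow> (nat \<Rightarrow> bool) \<Rightarrow> nat \<Rightarrow> bool list" where
  "row_code n r m = concat (map (\<lambda>x. map (\<lambda>y. r x \<and> r y \<and> x \<le> y) [0..<n]) [0..<m])"

definition prefs_code :: "nat \<Rightarrow> (nat \<Rightarrow> nat \<Rightarrow> bool) \<Rightarrow> (nat \<Rightarrow> nat) \<Rightarrow> nat \<Rightarrow> bool list" where
  "prefs_code n E c m = concat (map (\<lambda>a. if c a = 2 then row_code n (E a) n else []) [0..<m])"

lemma skip_simps [simp]: "loop_free skip" "cost skip = 1" "0 < k \<Longrightarrow> effect k skip s = s"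
  by (cases "s 0"; simp add: skip_def reads_def fun_upd_idem)+

definition adj_cost :: "nat \<Rightarrow> nat" where
  "adj_cost n = for_cost n 1 + for_cost n (for_cost n 3) + (2 * (n * n) + 5) + 2"

lemma adj_runs:
  assumes c: "coloured c"
  shows "runs 6 adj_prog
    (store6 (mat n E 0) (out w) (arr 0 n c 0) (arr 0 n c 0) t4 t5) (adj_cost n)
    (store6 (mat n E 0) (out (w @ map (\<lambda>v. c v = 2) [0..<n] @ arcs_code n E c n))
      (arr 0 n c 0) (arr 0 n c 0) t4 t5)"
proof -
  note nz = coloured_neq_0[OF c]
  let ?w = "w @ map (\<lambda>v. c v = 2) [0..<n]"
  have 1: "runs 6 (For 2 (Op 1 (\<lambda>\<sigma>. bitsym (\<sigma> 2 = 2)) 1))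
     ((store6 t0 (out (w @ map (\<lambda>v. c v = 2) [0..<0])) t2 t3 t4 t5)(2 := arr 0 n c 0))
     (for_cost n 1)
     ((store6 t0 (out (w @ map (\<lambda>v. c v = 2) [0..<n])) t2 t3 t4 t5)(2 := arr 0 n c 0))" for t0 t2 t3
  proof (rule For_runs, goal_cases)
    case (2 j)
    then show ?case
      by (intro runs_loop_freeI) (simp_all add: scan_arr act_out)
  qed (use nz in auto)
  have row: "runs 6 (For 3 (Op 1 (\<lambda>\<sigma>. bitsym (\<sigma> 2 = 2 \<and> \<sigma> 0 = 2)) 1 ;; goR 0))
     ((store6 (mat n E (u * n + 0)) (out (w' @ map (\<lambda>v. c u = 2 \<and> E u v) [0..<0])) (arr 0 n c u) t3 t4 t5)(3 := arr 0 n c 0))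
     (for_cost n 3)
     ((store6 (mat n E (u * n + n)) (out (w' @ map (\<lambda>v. c u = 2 \<and> E u v) [0..<n])) (arr 0 n c u) t3 t4 t5)(3 := arr 0 n c 0))"
    if u: "u < n" for u w' t3
  proof (rule For_runs, goal_cases)
    case (2 j)
    then show ?case using u
      by (intro runs_loop_freeI)
         (simp_all add: scan_arr act_out scan_mat advance_mat bitsym_eq_2)
  qed (use nz in auto)
  have arcs_Suc: "arcs_code n E c (Suc u) = arcs_code n E c u @ map (\<lambda>v. c u = 2 \<and> E u v) [0..<n]" for u
    by (simp add: arcs_code_def)
  have 2: "runs 6 (For 2 (For 3 (Op 1 (\<lambda>\<sigma>. bitsym (\<sigma> 2 = 2 \<and> \<sigma> 0 = 2)) 1 ;; goR 0)))
     ((store6 (mat n E (0 * n)) (out (?w @ arcs_code n E c 0)) t2 (arr 0 n c 0) t4 t5)(2 := arr 0 n c 0))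
     (for_cost n (for_cost n 3))
     ((store6 (mat n E (n * n)) (out (?w @ arcs_code n E c n)) t2 (arr 0 n c 0) t4 t5)(2 := arr 0 n c 0))" for t2
  proof (rule For_runs, goal_cases)
    case (2 u)
    show ?case using row[OF 2, of "?w @ arcs_code n E c u"] by (simp add: arcs_Suc add.commute)
  qed (use nz in auto)
  have e: "arcs_code n E c 0 = []" by (simp add: arcs_code_def)
  show ?thesis
    unfolding adj_prog_def adj_cost_def
    by (rule runs_mono[OF runs_Seq[OF 1[unfolded store6_simps upt_0 list.map append_Nil2]
          runs_Seq[OF 2[unfolded store6_simps mult_0 e append_Nil2, unfolded append_assoc] rewind_mat]]]) simp
qed

lemma cap_runs:
  assumes c: "coloured c"
  shows "runs 6 cap_prog (store6 t0 (out w) (arr 0 n c 0) t3 t4 t5) (for_cost n 9)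
    (store6 t0 (out (w @ caps_code c n)) (arr 0 n c 0) t3 t4 t5)"
proof -
  have "runs 6 cap_prog ((store6 t0 (out (w @ caps_code c 0)) t2 t3 t4 t5)(2 := arr 0 n c 0)) (for_cost n 9)
    ((store6 t0 (out (w @ caps_code c n)) t2 t3 t4 t5)(2 := arr 0 n c 0))" for t2
    unfolding cap_prog_def
  proof (rule For_runs, goal_cases)
    case (2 j)
    show ?case using 2
      by (intro runs_loop_freeI)
         (simp_all add: scan_arr act_out emit_def caps_code_def)
  qed (use coloured_neq_0[OF c] in auto)
  then show ?thesis by (simp add: caps_code_def)
qed

lemma row_runs:
  "runs 6 row_prog
    (store6 t0 (out w) t2 (arr 0 n (\<lambda>_. 1) 0) (arr 0 n (\<lambda>y. bitsym (r y)) 0) t5)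
    (for_cost n (for_cost n 7))
    (store6 t0 (out (w @ row_code n r n)) t2 (arr 0 n (\<lambda>x. if r x then 3 else 2) 0) (arr 0 n (\<lambda>_. 3) 0) t5)"
proof -
  \<comment> \<open>\<open>X x\<close> and \<open>Y x\<close> are tapes 3 and 4 at the start of row
    \<open>x\<close>. Within the row both change only at the diagonal position \<open>y = x\<close>,
    so \<open>d\<close> and \<open>g\<close> switch to the next row's contents as soon as
    \<open>y\<close> exceeds \<open>x\<close>.\<close>
  define X where "X x z = (if z < x then (if r z then 3 else 2) else 1 :: nat)" for x z :: nat
  define Y where "Y x z = (if z < x then 3 else bitsym (r z))" for x z :: nat
  define d where "d x y = (if x < y then X (Suc x) else X x)" for x y
  define g where "g x y = (if x < y then Y (Suc x) else Y x)" for x y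
  have row_Suc: "row_code n r (Suc x) = row_code n r x @ map (\<lambda>y. r x \<and> r y \<and> x \<le> y) [0..<n]" for x
    by (simp add: row_code_def)
  have inner: "runs 6 (For 4 (Cond (\<lambda>\<sigma>. \<sigma> 4 \<noteq> 3 \<and> \<sigma> 3 = 1)
     (Op 1 (\<lambda>\<sigma>. bitsym (\<sigma> 4 = 2)) 1 ;; Op 3 (\<lambda>\<sigma>. if \<sigma> 4 = 2 then 3 else 2) 0 ;; Op 4 (\<lambda>_. 3) 0)
     (Op 1 (\<lambda>\<sigma>. bitsym (\<sigma> 3 = 3 \<and> \<sigma> 4 = 2)) 1)))
     ((store6 t0 (out (w' @ map (\<lambda>y. r x \<and> r y \<and> x \<le> y) [0..<0])) t2 (arr 0 n (d x 0) x) t4 t5)(4 := arr 0 n (g x 0) 0))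
     (for_cost n 7)
     ((store6 t0 (out (w' @ map (\<lambda>y. r x \<and> r y \<and> x \<le> y) [0..<n])) t2 (arr 0 n (d x n) x) t4 t5)(4 := arr 0 n (g x n) 0))"
    if x: "x < n" for x w' t4
  proof (rule For_runs, goal_cases)
    case (2 y)
    consider "y < x" | "y = x" | "x < y" by linarith
    then show ?case
    proof cases
      case 1
      then have "g x y y = 3" "d x (Suc y) = d x y" "g x (Suc y) = g x y"
        by (simp_all add: g_def d_def Y_def)
      then show ?thesis using 1 2 x
        by (intro runs_loop_freeI) (simp_all add: scan_arr act_out)
    next
      case 2
      have "g x y y = bitsym (r x)" "d x y x = 1" "(d x y)(x := (if r x then 3 else 2)) = d x (Suc y)"
        "(g x y)(y := 3) = g x (Suc y)"
        using 2 by (auto simp: g_def d_def Y_def X_def fun_eq_iff less_Suc_eq)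
      moreover have "bitsym (r x) \<noteq> 3" by (simp add: bitsym_def)
      ultimately show ?thesis using 2 x
        by (intro runs_loop_freeI) (simp_all add: scan_arr act_out act_arr bitsym_eq_2)
    next
      case 3
      have "g x y y = bitsym (r y)" "d x y x = (if r x then 3 else 2)" "d x (Suc y) = d x y"
        "g x (Suc y) = g x y"
        using 3 by (auto simp: g_def d_def Y_def X_def)
      then show ?thesis using 2 3 x
        by (intro runs_loop_freeI) (simp_all add: scan_arr act_out act_arr bitsym_eq_2)
    qed
  next
    case 3
    then show ?case by (simp add: g_def Y_def bitsym_def)
  qed simp
  have dg: "d x 0 = X x" "x < n \<Longrightarrow> d x n = X (Suc x)" "g x 0 = Y x" "x < n \<Longrightarrow> g x n = Y (Suc x)" for x
    by (simp_all add: d_def g_def)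
  have "runs 6 row_prog
    ((store6 t0 (out (w @ row_code n r 0)) t2 t3 (arr 0 n (Y 0) 0) t5)(3 := arr 0 n (X 0) 0))
    (for_cost n (for_cost n 7))
    ((store6 t0 (out (w @ row_code n r n)) t2 t3 (arr 0 n (Y n) 0) t5)(3 := arr 0 n (X n) 0))" for t3
    unfolding row_prog_def
  proof (rule For_runs, goal_cases)
    case (2 x)
    show ?case using inner[OF 2, of "w @ row_code n r x"]
      by (simp add: dg 2 row_Suc)
  qed (simp_all add: X_def)
  moreover have "arr 0 n (Y n) 0 = arr 0 n (\<lambda>_. 3) 0" by (rule arr_cong) (simp add: Y_def)
  moreover have "arr 0 n (X n) 0 = arr 0 n (\<lambda>x. if r x then 3 else 2) 0" by (rule arr_cong) (simp add: X_def)
  moreover have "X 0 = (\<lambda>_. 1)" "Y 0 = (\<lambda>y. bitsym (r y))" by (simp_all add: X_def Y_def fun_eq_iff)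
  ultimately show ?thesis by (simp add: row_code_def)
qed

lemma copy_runs:
  assumes u: "u < n" and d: "\<And>v. d v \<noteq> 0"
  shows "runs 6 copy_prog
    (store6 (mat n E (u * n)) t1 t2 (arr 0 n d 0) (arr 0 n g 0) t5) (for_cost n 5 + (2 * n + 5) + 1)
    (store6 (mat n E (Suc u * n)) t1 t2 (arr 0 n (\<lambda>_. 1) 0) (arr 0 n (\<lambda>y. bitsym (E u y)) 0) t5)"
proof -
  define D where "D j v = (if v < j then 1 else d v)" for j v :: nat
  define G where "G j v = (if v < j then bitsym (E u v) else g v)" for j v :: nat
  have 1: "runs 6 (For 3 (Op 4 (\<lambda>\<sigma>. \<sigma> 0) 1 ;; Op 3 (\<lambda>_. 1) 0 ;; goR 0))
    ((store6 (mat n E (u * n + 0)) t1 t2 t3 (arr 0 n (G 0) 0) t5)(3 := arr 0 n (D 0) 0))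
    (for_cost n 5)
    ((store6 (mat n E (u * n + n)) t1 t2 t3 (arr 0 n (G n) n) t5)(3 := arr 0 n (D n) 0))" for t3
  proof (rule For_runs, goal_cases)
    case (2 j)
    have "(D j)(j := 1) = D (Suc j)" "(G j)(j := bitsym (E u j)) = G (Suc j)"
      by (auto simp: D_def G_def fun_eq_iff less_Suc_eq)
    then show ?case using 2 u
      by (intro runs_loop_freeI) (simp_all add: scan_mat advance_mat act_arr)
  qed (use d in \<open>simp_all add: D_def\<close>)
  have e: "arr 0 n (G n) n = arr 0 n (\<lambda>y. bitsym (E u y)) n" "arr 0 n (D n) 0 = arr 0 n (\<lambda>_. 1) 0"
    "D 0 = d" "G 0 = g" "u * n + n = Suc u * n"
    by (auto simp: D_def G_def fun_eq_iff intro!: arr_cong)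
  have 2: "runs 6 (rewind 4) (store6 t0 t1 t2 t3 (arr 0 n (\<lambda>y. bitsym (E u y)) n) t5) (2 * n + 5)
    (store6 t0 t1 t2 t3 (arr 0 n (\<lambda>y. bitsym (E u y)) 0) t5)" for t0 t3
    using rewind_runs[of 4 6 "store6 t0 t1 t2 t3 (arr 0 n (\<lambda>y. bitsym (E u y)) n) t5" 0 n "\<lambda>y. bitsym (E u y)" n]
    by (simp add: bitsym_neq_0)
  show ?thesis
    unfolding copy_prog_def using runs_Seq[OF 1[unfolded store6_simps e add_0_right] 2] .
qed

definition pref_cost :: "nat \<Rightarrow> nat" where
  "pref_cost n = for_cost n (for_cost n 5 + (2 * n + 5) + 1 + (for_cost n (for_cost n 7) + 1 + 1) + 1)"

lemma pref_runs:
  assumes c: "coloured c"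
  shows "\<exists>t3 t4 t0. runs 6 pref_prog
    (store6 (mat n E 0) (out w) (arr 0 n c 0) (arr 0 n c 0) (arr 0 n (\<lambda>_. 1) 0) t5) (pref_cost n)
    (store6 t0 (out (w @ prefs_code n E c n)) (arr 0 n c 0) t3 t4 t5)"
proof -
  \<comment> \<open>\<open>D j\<close> and \<open>G j\<close> describe what the vertex before
    \<open>j\<close> left on tapes 3 and 4. \<open>copy_prog\<close> overwrites both, and for its
    sweep it only matters that \<open>D j\<close> has no blanks.\<close>
  define D where "D j = (case j of 0 \<Rightarrow> c | Suc u \<Rightarrow>
     if c u = 2 then (\<lambda>x. if E u x then 3 else 2) else (\<lambda>_. 1))" for j
  define G where "G j = (case j of 0 \<Rightarrow> (\<lambda>_. 1) | Suc u \<Rightarrow>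
     if c u = 2 then (\<lambda>_. 3) else (\<lambda>y. bitsym (E u y)))" for j
  have D: "D j v \<noteq> 0" for j v
    using coloured_neq_0[OF c] by (simp add: D_def split: nat.split)
  have "runs 6 pref_prog
    ((store6 (mat n E (0 * n)) (out (w @ prefs_code n E c 0)) t2 (arr 0 n (D 0) 0) (arr 0 n (G 0) 0) t5)(2 := arr 0 n c 0))
    (pref_cost n)
    ((store6 (mat n E (n * n)) (out (w @ prefs_code n E c n)) t2 (arr 0 n (D n) 0) (arr 0 n (G n) 0) t5)(2 := arr 0 n c 0))" for t2
    unfolding pref_prog_def pref_cost_def
  proof (rule For_runs, goal_cases)
    case (2 u)
    let ?s = "store6 (mat n E (Suc u * n)) (out (w @ prefs_code n E c u)) (arr 0 n c u)
       (arr 0 n (\<lambda>_. 1) 0) (arr 0 n (\<lambda>y. bitsym (E u y)) 0) t5"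
    let ?s' = "store6 (mat n E (Suc u * n)) (out (w @ prefs_code n E c (Suc u))) (arr 0 n c u)
       (arr 0 n (D (Suc u)) 0) (arr 0 n (G (Suc u)) 0) t5"
    have "runs 6 (Cond (\<lambda>\<sigma>. \<sigma> 2 = 2) row_prog skip) ?s (for_cost n (for_cost n 7) + 1 + 1) ?s'"
    proof (cases "c u = 2")
      case True
      then have "runs 6 row_prog ?s (for_cost n (for_cost n 7)) ?s'"
        using row_runs[of _ "w @ prefs_code n E c u" _ n "E u"]
        by (simp add: D_def G_def prefs_code_def)
      then show ?thesis
        by (intro runs_Cond) (use True 2 in \<open>auto simp: scan_arr elim: runs_mono\<close>)
    next
      case False
      then have "?s' = ?s" by (simp add: D_def G_def prefs_code_def)
      moreover have "runs 6 skip ?s 1 ?s"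
        by (intro runs_loop_freeI) simp_all
      ultimately show ?thesis
        by (intro runs_Cond) (use False 2 in \<open>auto simp: scan_arr elim: runs_mono\<close>)
    qed
    then show ?case
      unfolding store6_simps by (rule runs_Seq[OF copy_runs[OF 2 D]])
  qed (use coloured_neq_0[OF c] in auto)
  moreover have "D 0 = c" "G 0 = (\<lambda>_. 1)" "prefs_code n E c 0 = []"
    by (simp_all add: prefs_code_def D_def G_def)
  ultimately show ?thesis
    unfolding store6_simps mult_0 by (metis append_Nil2)
qed

text \<open>Links the nested comprehension of the encoding to the flat
  \<open>div\<close>/\<open>mod\<close> indexing of \<open>mat\<close>.\<close>

lemma concat_rows:
  "concat (map (\<lambda>u. map (\<lambda>v. f u v) [0..<n]) [0..<m]) = map (\<lambda>i. f (i div n) (i mod n)) [0..<m * n]"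
proof (induction m)
  case (Suc m)
  have "[0..<Suc m * n] = [0..<m * n] @ map (\<lambda>v. m * n + v) [0..<n]"
    using upt_add_eq_append[of 0 "m * n" n] map_add_upt[of "m * n" n] by (simp add: add.commute)
  then show ?case using Suc by (simp add: o_def cong: map_cong)
qed simp

definition init_cost :: "nat \<Rightarrow> nat" where
  "init_cost n = n * 12 + 1 + 4 * (2 * n + 5) + 8"

lemma init_runs:
  "runs 6 init_prog
    (init_store (enc_unary n @ concat (map (\<lambda>u. map (\<lambda>v. E u v) [0..<n]) [0..<n]))) (init_cost n)
    (store6 (mat n E 0) (out (enc_unary n)) (arr 0 n (\<lambda>_. 1) 0) (arr 0 n (\<lambda>_. 1) 0)
       (arr 0 n (\<lambda>_. 1) 0) (arr 0 n (\<lambda>_. 1) 0))"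
proof -
  let ?w = "enc_unary n @ concat (map (\<lambda>u. map (\<lambda>v. E u v) [0..<n]) [0..<n])"
  define W where "W = word_tape ?w"
  \<comment> \<open>The input tape with its first \<open>j\<close> cells erased and the head behind
    them; erasing the terminator as well turns it into \<open>mat n E 0\<close>.\<close>
  define T where "T j = ((\<lambda>i. if i < int j then 0 else W i), int j)" for j
  have lt: "int i < 1 + (int n + int n * int n) \<longleftrightarrow> i < Suc (n + n * n)" for i
    by (metis of_nat_Suc of_nat_add of_nat_mult of_nat_less_iff)
  have W: "W (int i) = (if i < n then 2 else if i = n then 1 else
      if i < Suc n + n * n then bitsym (E ((i - Suc n) div n) ((i - Suc n) mod n)) else 0)" for i
    by (auto simp: W_def word_tape_def enc_unary_def nth_append bitsym_def concat_rows lt)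
  have Wneg: "i < 0 \<Longrightarrow> W i = 0" for i by (simp add: W_def word_tape_def)
  let ?a = "\<lambda>j. arr 0 j (\<lambda>_. 1) j"
  define S where "S j = store6 (T j) (out (replicate j True)) (?a j) (?a j) (?a j) (?a j)" for j
  have app: "act (1, 1) (?a j) = ?a (Suc j)" for j
    unfolding act_arr_append by (rule arr_cong) simp
  have T: "act (0, 1) (T j) = T (Suc j)" for j by (auto simp: T_def fun_eq_iff)
  have 1: "runs 6 (Loop (\<lambda>\<sigma>. \<sigma> 0 = 2)
     (emit True ;; Op 2 (\<lambda>_. 1) 1 ;; Op 3 (\<lambda>_. 1) 1 ;; Op 4 (\<lambda>_. 1) 1 ;; Op 5 (\<lambda>_. 1) 1 ;;
      Op 0 (\<lambda>_. 0) 1)) (S 0) (n * (11 + 1) + 1) (S n)"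
  proof (rule runs_Loop)
    fix j assume "j < n"
    then show "reads 6 (S j) 0 = 2" by (simp add: S_def T_def W)
    show "runs 6 (emit True ;; Op 2 (\<lambda>_. 1) 1 ;; Op 3 (\<lambda>_. 1) 1 ;; Op 4 (\<lambda>_. 1) 1 ;; Op 5 (\<lambda>_. 1) 1 ;;
      Op 0 (\<lambda>_. 0) 1) (S j) 11 (S (Suc j))"
      using app T by (intro runs_loop_freeI)
        (simp_all add: S_def emit_def act_out replicate_append_same)
  qed (simp add: S_def T_def W)
  have T_mat: "T (Suc n) = mat n E 0"
  proof -
    have "(if i < int (Suc n) then 0 else W i) = fst (mat n E 0) i" for i
    proof (cases "i < 0")
      case False
      then obtain k where "i = int k" using nonneg_int_cases by (metis not_less)
      moreover have "int k < 1 + int n \<longleftrightarrow> k < Suc n" "nat (1 + int n) = Suc n" by linarith+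
      ultimately show ?thesis
        by (auto simp: W mat_def arr_def nat_diff_distrib lt[unfolded add.assoc[symmetric]])
    qed (simp add: Wneg mat_def arr_def)
    then show ?thesis by (auto simp: T_def mat_def arr_def)
  qed
  let ?b = "arr 0 n (\<lambda>_. 1) 0"
  have 2: "runs 6 (emit False) (S n) 1 (store6 (T n) (out (enc_unary n)) (?a n) (?a n) (?a n) (?a n))"
    by (intro runs_loop_freeI) (simp_all add: S_def emit_def act_out enc_unary_def)
  have 3: "runs 6 (Op 0 (\<lambda>_. 0) 1) (store6 (T n) t1 t2 t3 t4 t5) 1 (store6 (mat n E 0) t1 t2 t3 t4 t5)" for t1 t2 t3 t4 t5
    by (intro runs_loop_freeI) (simp_all add: T T_mat)
  have r: "i < 6 \<Longrightarrow> s i = ?a n \<Longrightarrow> runs 6 (rewind i) s (2 * n + 5) (s(i := ?b))" for i s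
    using rewind_runs[of i 6 s 0 n "\<lambda>_. 1" n] by simp
  have 4: "runs 6 (rewind 2) (store6 t0 t1 (?a n) t3 t4 t5) (2 * n + 5) (store6 t0 t1 ?b t3 t4 t5)" for t0 t1 t3 t4 t5
    using r[of 2 "store6 t0 t1 (?a n) t3 t4 t5"] by simp
  have 5: "runs 6 (rewind 3) (store6 t0 t1 t2 (?a n) t4 t5) (2 * n + 5) (store6 t0 t1 t2 ?b t4 t5)" for t0 t1 t2 t4 t5
    using r[of 3 "store6 t0 t1 t2 (?a n) t4 t5"] by simp
  have 6: "runs 6 (rewind 4) (store6 t0 t1 t2 t3 (?a n) t5) (2 * n + 5) (store6 t0 t1 t2 t3 ?b t5)" for t0 t1 t2 t3 t5
    using r[of 4 "store6 t0 t1 t2 t3 (?a n) t5"] by simp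
  have 7: "runs 6 (rewind 5) (store6 t0 t1 t2 t3 t4 (?a n)) (2 * n + 5) (store6 t0 t1 t2 t3 t4 ?b)" for t0 t1 t2 t3 t4
    using r[of 5 "store6 t0 t1 t2 t3 t4 (?a n)"] by simp
  have S0: "S 0 = init_store ?w"
    by (auto simp: S_def store6_def init_store_def T_def W_def[symmetric] fun_eq_iff out_def arr_def
        word_tape_def[of "[]"] Wneg)
  show ?thesis
    unfolding init_prog_def init_cost_def S0[symmetric]
    by (rule runs_mono[OF runs_Seq[OF 1 runs_Seq[OF 2 runs_Seq[OF 3 runs_Seq[OF 4 runs_Seq[OF 5
          runs_Seq[OF 6 7]]]]]]]) simp
qed

definition red_cost :: "nat \<Rightarrow> nat" where
  "red_cost n = init_cost n + (colour_cost n + (adj_cost n + (for_cost n 9 + pref_cost n + 1) + 1) + 1) + 1"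

definition red_code :: "nat \<Rightarrow> (nat \<Rightarrow> nat \<Rightarrow> bool) \<Rightarrow> (nat \<Rightarrow> nat) \<Rightarrow> bool list" where
  "red_code n E c = enc_unary n @ map (\<lambda>v. c v = 2) [0..<n] @ arcs_code n E c n @ caps_code c n @
     prefs_code n E c n"

lemma red_runs:
  "\<exists>s. runs 6 red_prog
    (init_store (enc_unary n @ concat (map (\<lambda>u. map (\<lambda>v. E u v) [0..<n]) [0..<n]))) (red_cost n) s \<and>
    fst (s 1) = word_tape (red_code n E (colouring n E))"
proof -
  let ?c = "colouring n E"
  note c = coloured_colouring[of n E]
  let ?w = "(enc_unary n @ map (\<lambda>v. ?c v = 2) [0..<n] @ arcs_code n E ?c n) @ caps_code ?c n"
  obtain t3 t4 t0 where p: "runs 6 pref_prog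
    (store6 (mat n E 0) (out ?w) (arr 0 n ?c 0) (arr 0 n ?c 0) (arr 0 n (\<lambda>_. 1) 0) (arr 0 n (\<lambda>_. 1) 0))
    (pref_cost n)
    (store6 t0 (out (?w @ prefs_code n E ?c n)) (arr 0 n ?c 0) t3 t4 (arr 0 n (\<lambda>_. 1) 0))"
    using pref_runs[OF c] by blast
  show ?thesis
    unfolding red_prog_def red_cost_def
    by (rule exI, rule conjI, rule runs_Seq[OF init_runs runs_Seq[OF colour_runs runs_Seq[OF
      adj_runs[OF c] runs_Seq[OF cap_runs[OF c] p]]]])
       (simp add: out_def red_code_def)
qed

section \<open>Polynomial time bounds\<close>

definition poly_bound :: "(nat \<Rightarrow> nat) \<Rightarrow> bool" where
  "poly_bound f \<longleftrightarrow> (\<exists>p. \<forall>n. f n = poly p n)"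

lemma poly_bound_intros:
  "poly_bound (\<lambda>n. n)" "poly_bound (\<lambda>_. a)"
  "poly_bound f \<Longrightarrow> poly_bound g \<Longrightarrow> poly_bound (\<lambda>n. f n + g n)"
  "poly_bound f \<Longrightarrow> poly_bound g \<Longrightarrow> poly_bound (\<lambda>n. f n * g n)"
proof -
  show "poly_bound (\<lambda>n. n)" unfolding poly_bound_def by (rule exI[of _ "[:0, 1:]"]) simp
  show "poly_bound (\<lambda>_. a)" unfolding poly_bound_def by (rule exI[of _ "[:a:]"]) simp
  assume "poly_bound f" "poly_bound g"
  then obtain p q where "\<forall>n. f n = poly p n" "\<forall>n. g n = poly q n" by (auto simp: poly_bound_def)
  then have "\<forall>n. f n + g n = poly (p + q) n" "\<forall>n. f n * g n = poly (p * q) n" by simp_all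
  then show "poly_bound (\<lambda>n. f n + g n)" "poly_bound (\<lambda>n. f n * g n)"
    unfolding poly_bound_def by blast+
qed

text \<open>All cost functions are built from \<open>n\<close> and constants by sums and products,
  so the closure rules alone decide the goal.\<close>

lemma poly_bound_red_cost: "poly_bound red_cost"
  unfolding red_cost_def[abs_def] init_cost_def colour_cost_def adj_cost_def pref_cost_def
    seed_cost_def relax_cost_def for_cost_def
  by (intro poly_bound_intros)

text \<open>Coefficients are natural numbers. Needed to pass from a bound in \<open>n\<close> to one
  in the length of the input code.\<close>

lemma poly_nat_mono: "m \<le> n \<Longrightarrow> poly p m \<le> poly p (n :: nat)"
  by (induction p) (auto intro: add_mono mult_mono)

section \<open>Correctness of the colouring\<close>

definition proper :: "nat \<Rightarrow> (nat \<Rightarrow> nat \<Rightarrow> bool) \<Rightarrow> (nat \<Rightarrow> nat) \<Rightarrow> bool" where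
  "proper n E \<psi> \<longleftrightarrow> (\<forall>v. \<psi> v = 2 \<or> \<psi> v = 3) \<and> (\<forall>u<n. \<forall>v<n. E u v \<longrightarrow> \<psi> u \<noteq> \<psi> v)"

definition extends :: "nat \<Rightarrow> (nat \<Rightarrow> nat) \<Rightarrow> (nat \<Rightarrow> nat) \<Rightarrow> bool" where
  "extends n \<psi> c \<longleftrightarrow> (\<forall>v<n. c v \<noteq> 1 \<longrightarrow> c v = \<psi> v)"

definition settled :: "nat \<Rightarrow> (nat \<Rightarrow> nat) \<Rightarrow> nat set" where
  "settled n c = {v. v < n \<and> c v \<noteq> 1}"

text \<open>For symmetric \<open>E\<close>, the coloured vertices below \<open>n\<close> form a
  union of connected components.\<close>

definition closed_col :: "nat \<Rightarrow> (nat \<Rightarrow> nat \<Rightarrow> bool) \<Rightarrow> (nat \<Rightarrow> nat) \<Rightarrow> bool" where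
  "closed_col n E c \<longleftrightarrow> (\<forall>u<n. \<forall>v<n. E u v \<longrightarrow> c u \<noteq> 1 \<longrightarrow> c v \<noteq> 1)"

lemma settled_subset: "settled n c \<subseteq> {..<n}" and finite_settled: "finite (settled n c)"
  by (auto simp: settled_def)

lemma card_settled_le: "card (settled n c) \<le> n"
  using card_mono[OF _ settled_subset[of n c]] by simp

text \<open>A coloured \<open>u\<close> agrees with \<open>\<psi>\<close>, so an edge to
  \<open>v\<close> forces \<open>\<psi> v = 5 - \<psi> u\<close>. This is the value written, hence
  overwriting an existing colour does no harm.\<close>

lemma extends_relax:
  assumes "proper n E \<psi>" "extends n \<psi> c" "u \<le> n"
  shows "extends n \<psi> (relax E c u)"
  using assms(3)
proof (induction u)
  case 0
  then show ?case using assms by (simp add: extends_def)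
next
  case (Suc u)
  have "relax E c (Suc u) v = \<psi> v" if "v < n" "relax E c (Suc u) v \<noteq> 1" for v
  proof (cases "E u v \<and> (c u = 2 \<or> c u = 3)")
    case True
    then have "c u = \<psi> u" using assms(2) Suc.prems by (auto simp: extends_def)
    moreover have "\<psi> u \<noteq> \<psi> v" "\<psi> u = 2 \<or> \<psi> u = 3" "\<psi> v = 2 \<or> \<psi> v = 3"
      using assms(1) True that Suc.prems by (auto simp: proper_def)
    ultimately show ?thesis using True by auto
  next
    case False
    then show ?thesis using Suc that by (auto simp: extends_def)
  qed
  then show ?case by (simp add: extends_def del: relax.simps)
qed

lemma relax_neq_1:
  assumes "coloured c"
  shows "relax E c u v \<noteq> 1 \<longleftrightarrow> c v \<noteq> 1 \<or> (\<exists>u'<u. E u' v \<and> c u' \<noteq> 1)"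
proof (induction u)
  case (Suc u)
  have "c u = 1 \<or> c u = 2 \<or> c u = 3" using assms by (auto simp: coloured_def)
  then show ?case using Suc by (auto simp: less_Suc_eq)
qed simp

lemma settled_relax:
  assumes "coloured c"
  shows "settled n (relax E c n) = settled n c \<union> {v. v < n \<and> (\<exists>u<n. E u v \<and> c u \<noteq> 1)}"
  using relax_neq_1[OF assms, of E n] by (auto simp: settled_def)

text \<open>A round starting from a set that is not closed colours a new vertex, and a closed set
  stays as it is. Counting vertices in this way avoids any argument about distances in the
  graph.\<close>

lemma closed_or_grow:
  assumes "coloured c"
  shows "closed_col n E (((\<lambda>c. relax E c n) ^^ m) c) \<or>
    card (settled n c) + m \<le> card (settled n (((\<lambda>c. relax E c n) ^^ m) c))"
proof (induction m)
  case (Suc m)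
  let ?g = "((\<lambda>c. relax E c n) ^^ m) c"
  note g = coloured_rounds[OF assms, where E = E and n = n and m = m]
  have sub: "settled n ?g \<subseteq> settled n (relax E ?g n)" using settled_relax[OF g] by blast
  show ?case
  proof (cases "closed_col n E ?g")
    case True
    then have "relax E ?g n v \<noteq> 1 \<longleftrightarrow> ?g v \<noteq> 1" if "v < n" for v
      using relax_neq_1[OF g, of E n v] that unfolding closed_col_def by blast
    then have "closed_col n E (relax E ?g n)"
      using True unfolding closed_col_def by blast
    then show ?thesis by simp
  next
    case False
    then have "settled n ?g \<noteq> settled n (relax E ?g n)"
      unfolding settled_relax[OF g] closed_col_def by (auto simp: settled_def)
    with sub have "card (settled n ?g) < card (settled n (relax E ?g n))"
      by (intro psubset_card_mono finite_settled) blast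
    with Suc False show ?thesis by simp
  qed
qed simp

lemma full_closed: "n \<le> card (settled n c) \<Longrightarrow> settled n c = {..<n}"
  by (intro card_subset_eq settled_subset) (auto intro: antisym card_settled_le)

lemma closed_rounds:
  assumes "coloured c"
  shows "closed_col n E (((\<lambda>c. relax E c n) ^^ n) c)"
proof -
  let ?g = "((\<lambda>c. relax E c n) ^^ n) c"
  \<comment> \<open>If no round reaches a closed set, the growth accounts for \<open>n\<close>
    vertices; then all are coloured and the set is closed after all.\<close>
  have "closed_col n E ?g" if "n \<le> card (settled n ?g)"
    using full_closed[OF that] by (auto simp: closed_col_def settled_def)
  then show ?thesis using closed_or_grow[OF assms, of n E n] by auto
qed

lemma rounds_mono:
  assumes "coloured c"
  shows "settled n c \<subseteq> settled n (((\<lambda>c. relax E c n) ^^ m) c)"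
proof (induction m)
  case (Suc m)
  then show ?case using settled_relax[OF coloured_rounds[OF assms, where E = E and n = n and m = m], of n E] by auto
qed simp

lemma extends_rounds:
  assumes "proper n E \<psi>" "extends n \<psi> c"
  shows "extends n \<psi> (((\<lambda>c. relax E c n) ^^ m) c)"
  by (induction m) (auto intro: extends_relax assms)

text \<open>Closedness makes it possible to flip \<open>\<psi>\<close> on the vertices not yet coloured.\<close>

lemma extends_seed:
  assumes \<psi>: "proper n E \<psi>" and ext: "extends n \<psi> c" and cl: "closed_col n E c"
    and sym: "\<And>u v. E u v \<Longrightarrow> E v u"
  shows "\<exists>\<psi>'. proper n E \<psi>' \<and> extends n \<psi>' (seed c)"
proof (cases "\<exists>k<n. c k = 1 \<and> (\<forall>i<k. c i \<noteq> 1)")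
  case True
  then obtain k where k: "k < n" "c k = 1" "\<forall>i<k. c i \<noteq> 1" by blast
  have seed: "seed c v = (if v = k then 2 else c v)" for v
    using k by (auto simp: seed_def) (metis linorder_neqE_nat)
  define \<psi>' where "\<psi>' v = (if c v \<noteq> 1 \<or> \<psi> k = 2 then \<psi> v else 5 - \<psi> v)" for v
  have val: "\<psi> v = 2 \<or> \<psi> v = 3" for v using \<psi> by (simp add: proper_def)
  have "proper n E \<psi>'"
    unfolding proper_def
  proof (intro conjI allI impI)
    show "\<psi>' v = 2 \<or> \<psi>' v = 3" for v using val[of v] by (auto simp: \<psi>'_def)
    fix u v assume uv: "u < n" "v < n" "E u v"
    then have "\<psi> u \<noteq> \<psi> v" using \<psi> by (simp add: proper_def)
    moreover have "c u \<noteq> 1 \<longleftrightarrow> c v \<noteq> 1" using cl uv sym unfolding closed_col_def by blast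
    ultimately show "\<psi>' u \<noteq> \<psi>' v" using val[of u] val[of v] by (auto simp: \<psi>'_def)
  qed
  moreover have "extends n \<psi>' (seed c)"
    using ext val[of k] k by (auto simp: extends_def seed \<psi>'_def)
  ultimately show ?thesis by blast
next
  case False
  then have "seed c v = c v" if "v < n" for v using that by (auto simp: seed_def)
  then have "extends n \<psi> (seed c)" using ext by (simp add: extends_def)
  then show ?thesis using \<psi> by blast
qed

lemma seed_mono: "settled n c \<subseteq> settled n (seed c)"
  by (auto simp: settled_def seed_def)

lemma seed_grow:
  assumes "settled n c \<noteq> {..<n}"
  shows "card (settled n c) < card (settled n (seed c))"
proof -
  have ex: "\<exists>k. k < n \<and> c k = 1" using assms by (auto simp: settled_def)
  define k where "k = (LEAST k. k < n \<and> c k = 1)"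
  have k: "k < n" "c k = 1" using LeastI_ex[OF ex] by (auto simp: k_def)
  have "c i \<noteq> 1" if "i < k" for i using not_less_Least[of i "\<lambda>k. k < n \<and> c k = 1"] that k(1) unfolding k_def by auto
  with k have "seed c k \<noteq> 1" by (simp add: seed_def)
  with k have "k \<in> settled n (seed c) - settled n c" by (simp add: settled_def)
  then show ?thesis using seed_mono by (intro psubset_card_mono finite_settled) blast
qed

text \<open>The invariant only claims that some proper extension exists, since seeding may replace
  it by a flipped one. Each phase starts from a closed set and colours a further vertex until none
  is left, so after \<open>n\<close> phases the extension is the colouring itself.\<close>

lemma colouring_proper:
  assumes \<psi>: "proper n E \<psi>" and sym: "\<And>u v. E u v \<Longrightarrow> E v u"
  shows "(\<forall>v<n. colouring n E v = 2 \<or> colouring n E v = 3) \<and>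
    (\<forall>u<n. \<forall>v<n. E u v \<longrightarrow> colouring n E u \<noteq> colouring n E v)"
proof -
  let ?R = "\<lambda>c. relax E c n"
  define P where "P j = ((\<lambda>c. (?R ^^ n) (seed c)) ^^ j) (\<lambda>_. 1)" for j
  have P: "coloured (P j)" for j
    unfolding P_def by (rule coloured_phases) (simp add: coloured_def)
  have PSuc: "P (Suc j) = (?R ^^ n) (seed (P j))" for j by (simp add: P_def)
  have "closed_col n E (P j) \<and> (\<exists>\<psi>. proper n E \<psi> \<and> extends n \<psi> (P j)) \<and>
      (j \<le> card (settled n (P j)) \<or> settled n (P j) = {..<n})" for j
  proof (induction j)
    case 0
    then show ?case using \<psi> by (auto simp: P_def closed_col_def extends_def)
  next
    case (Suc j)
    have s: "coloured (seed (P j))" by (rule coloured_seed[OF P])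
    have "closed_col n E (P (Suc j))" unfolding PSuc by (rule closed_rounds[OF s])
    moreover have "\<exists>\<psi>. proper n E \<psi> \<and> extends n \<psi> (P (Suc j))"
      unfolding PSuc using Suc extends_seed[OF _ _ _ sym] extends_rounds by meson
    moreover have "Suc j \<le> card (settled n (P (Suc j))) \<or> settled n (P (Suc j)) = {..<n}"
    proof (cases "settled n (P j) = {..<n}")
      case True
      then show ?thesis unfolding PSuc
        using seed_mono[of n "P j"] rounds_mono[OF s, where E = E and n = n and m = n] settled_subset by blast
    next
      case False
      have "card (settled n (seed (P j))) \<le> card (settled n (P (Suc j)))"
        unfolding PSuc by (intro card_mono finite_settled rounds_mono[OF s])
      then show ?thesis using seed_grow[OF False] Suc False by linarith
    qed
    ultimately show ?case by blast
  qed
  from this[of n] obtain \<psi> where "proper n E \<psi>" "extends n \<psi> (P n)" "settled n (P n) = {..<n}"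
    using full_closed by blast
  moreover then have "P n v = \<psi> v" if "v < n" for v
    using that by (auto simp: extends_def settled_def)
  moreover have "P n = colouring n E" by (simp add: P_def colouring_def)
  ultimately show ?thesis by (auto simp: proper_def)
qed


section \<open>Matchings and solutions\<close>

text \<open>Collects what the two inequalities need to know about the constructed instance, detached
  from how the split into agents and centers is found.\<close>

locale bipartite_instance =
  fixes G :: "nat ugraph" and P :: "nat dcl_instance"
  assumes simple: "simple_graph G"
    and verts: "verts G = agents P \<union> centers P"
    and disjoint: "agents P \<inter> centers P = {}"
    and edge: "\<And>e. e \<in> edges G \<Longrightarrow> \<exists>a\<in>agents P. \<exists>l\<in>centers P. e = {a, l}"
    and arcs: "arcs P = {(a, l). a \<in> agents P \<and> l \<in> centers P \<and> {a, l} \<in> edges G}"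
    and cap: "\<And>l. l \<in> centers P \<Longrightarrow> cap P l = 1"
    and pref: "\<And>a. a \<in> agents P \<Longrightarrow> pref P a = {(x, y). x \<in> nbrs P a \<and> y \<in> nbrs P a \<and> x \<le> y}"
begin

lemma finite_verts: "finite (verts G)" "finite (agents P)" "finite (centers P)" "finite (edges G)"
proof -
  show v: "finite (verts G)" using simple by (simp add: simple_graph_def)
  then show "finite (agents P)" "finite (centers P)" by (simp_all add: verts)
  have "edges G \<subseteq> Pow (verts G)" using simple by (auto simp: simple_graph_def)
  then show "finite (edges G)" using v finite_subset by blast
qed

lemma nbrs: "nbrs P a = {l. a \<in> agents P \<and> l \<in> centers P \<and> {a, l} \<in> edges G}"
  by (simp add: nbrs_def arcs)

lemma valid: "valid_dcl P"
proof -
  have "linear_order_on (nbrs P a) (pref P a)" if "a \<in> agents P" for a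
    unfolding pref[OF that] linear_order_on_def partial_order_on_def preorder_on_def
    by (auto simp: refl_on_def trans_def antisym_def total_on_def)
  then show ?thesis
    using disjoint finite_verts by (auto simp: valid_dcl_def arcs)
qed

lemma finite_solution_sizes: "finite {card A' | L' A' f. dcl_solution P L' A' f}"
  by (rule finite_subset[of _ "{..card (agents P)}"])
     (auto simp: dcl_solution_def intro: card_mono finite_verts)

section \<open>From induced matchings to solutions\<close>

lemma induced_matching_solution:
  assumes M: "induced_matching G M"
  shows "\<exists>L' A' f. dcl_solution P L' A' f \<and> card A' = card M"
proof -
  define A' where "A' = agents P \<inter> \<Union>M"
  define L' where "L' = centers P \<inter> \<Union>M"
  define f where "f a = (SOME l. {a, l} \<in> M)" for a
  have sub: "M \<subseteq> edges G" and disj: "\<And>e e'. e \<in> M \<Longrightarrow> e' \<in> M \<Longrightarrow> e \<inter> e' \<noteq> {} \<Longrightarrow> e = e'"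
    using M by (auto simp: induced_matching_def matching_def)
  have ind: "{u, v} \<notin> edges G" if "e \<in> M" "e' \<in> M" "e \<noteq> e'" "u \<in> e" "v \<in> e'" for e e' u v
    using M that by (simp add: induced_matching_def)
  have f: "{a, f a} \<in> M \<and> f a \<in> centers P" if "a \<in> A'" for a
  proof -
    from that obtain e where e: "e \<in> M" "a \<in> e" "a \<in> agents P"
      unfolding A'_def by blast
    then obtain b l where bl: "b \<in> agents P" "l \<in> centers P" "e = {b, l}" using edge sub by blast
    then have "{a, l} \<in> M" using e disjoint by auto
    then have 1: "{a, f a} \<in> M" unfolding f_def by (rule someI)
    then obtain b' l' where "b' \<in> agents P" "l' \<in> centers P" "{a, f a} = {b', l'}"
      using edge sub by blast
    then show ?thesis using 1 e(3) disjoint by (auto simp: doubleton_eq_iff)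
  qed
  have fI: "f a = l" if "{a, l} \<in> M" "a \<in> agents P" for a l
  proof -
    have "a \<in> A'" using that by (auto simp: A'_def)
    then have "{a, f a} = {a, l}" using f disj that(1) by blast
    then show ?thesis by (auto simp: doubleton_eq_iff)
  qed
  have inj: "inj_on f A'"
  proof (rule inj_onI)
    fix a b assume ab: "a \<in> A'" "b \<in> A'" "f a = f b"
    then have "{a, f a} = {b, f b}" using f[of a] f[of b] disj[of "{a, f a}" "{b, f b}"] by auto
    then show "a = b" using ab(3) by (auto simp: doubleton_eq_iff)
  qed
  have "bij_betw (\<lambda>a. {a, f a}) A' M"
    unfolding bij_betw_def
  proof
    show "inj_on (\<lambda>a. {a, f a}) A'"
    proof (rule inj_onI)
      fix a b assume ab: "a \<in> A'" "b \<in> A'" "{a, f a} = {b, f b}"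
      then have "a \<noteq> f b" using f disjoint by (auto simp: A'_def)
      with ab(3) show "a = b" by (auto simp: doubleton_eq_iff)
    qed
    show "(\<lambda>a. {a, f a}) ` A' = M"
    proof
      show "M \<subseteq> (\<lambda>a. {a, f a}) ` A'"
      proof
        fix e assume e: "e \<in> M"
        then obtain a l where al: "a \<in> agents P" "l \<in> centers P" "e = {a, l}" using edge sub by blast
        then have "f a = l" "a \<in> A'" using e fI by (auto simp: A'_def)
        then show "e \<in> (\<lambda>a. {a, f a}) ` A'" using al by auto
      qed
    qed (use f in auto)
  qed
  then have "card A' = card M" by (rule bij_betw_same_card)
  moreover have "dcl_solution P L' A' f"
    unfolding dcl_solution_def
  proof (intro conjI ballI)
    fix l assume l: "l \<in> centers P"
    have "card {a \<in> A'. f a = l} \<le> Suc 0"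
      using inj finite_verts(2) by (subst card_le_Suc0_iff_eq) (auto simp: A'_def inj_on_def)
    then show "int (card {a \<in> A'. f a = l}) \<le> cap P l" using cap[OF l] by simp
  next
    fix a assume a: "a \<in> A'"
    then show fa: "f a \<in> nbrs P a \<inter> L'"
      using f[OF a] sub by (auto simp: nbrs L'_def A'_def)
    fix l assume l: "l \<in> nbrs P a \<inter> L'"
    then obtain e where e: "e \<in> M" "l \<in> e" by (auto simp: L'_def)
    have ae: "{a, l} \<in> edges G" using l by (simp add: nbrs)
    \<comment> \<open>Otherwise the edge from \<open>a\<close> to the open center \<open>l\<close>
      would join two distinct edges of the induced matching.\<close>
    have "e = {a, f a}"
      using ind[of "{a, f a}" e a l] e f[OF a] ae by blast
    then have "l = f a" using e(2) l a disjoint by (auto simp: nbrs A'_def)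
    then show "(l, f a) \<in> pref P a" using fa a by (simp add: pref A'_def)
  qed (auto simp: A'_def L'_def)
  ultimately show ?thesis by blast
qed

lemma im_le_OPT: "im G \<le> OPT P"
  unfolding im_def
proof (rule Max.boundedI)
  show "finite {card M | M. induced_matching G M}"
    by (rule finite_subset[of _ "{..card (edges G)}"])
       (auto simp: induced_matching_def matching_def intro: card_mono finite_verts)
  show "{card M | M. induced_matching G M} \<noteq> {}"
    by (auto simp: induced_matching_def matching_def intro!: exI[of _ "{}"])
  fix k assume "k \<in> {card M | M. induced_matching G M}"
  then obtain L' A' f where "dcl_solution P L' A' f" "k = card A'"
    using induced_matching_solution by fastforce
  then show "k \<le> OPT P"
    unfolding OPT_def using finite_solution_sizes by (intro Max_ge) auto
qed

section \<open>From solutions to semi-induced matchings\<close>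

lemma vertex_order_of_key:
  assumes inj: "inj_on key (verts G)"
  shows "\<exists>\<sigma>. vertex_order G \<sigma> \<and> (\<forall>u\<in>verts G. \<forall>v\<in>verts G. \<sigma> u < \<sigma> v \<longrightarrow> key u < (key v :: nat))"
proof -
  let ?V = "verts G"
  \<comment> \<open>The rank of \<open>v\<close> by key; counting \<open>v\<close> itself makes the
    ranks start at 1.\<close>
  define \<sigma> where "\<sigma> v = card {w \<in> ?V. key w \<le> key v}" for v
  note fin = finite_verts(1)
  have mono: "\<sigma> u \<le> \<sigma> v" if "key u \<le> key v" for u v
    unfolding \<sigma>_def using fin that by (intro card_mono) auto
  have smono: "\<sigma> u < \<sigma> v" if "key u < key v" "v \<in> ?V" for u v
    unfolding \<sigma>_def
  proof (rule psubset_card_mono)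
    show "{w \<in> ?V. key w \<le> key u} \<subset> {w \<in> ?V. key w \<le> key v}"
    proof
      show "{w \<in> ?V. key w \<le> key u} \<subseteq> {w \<in> ?V. key w \<le> key v}" using that by auto
      have "v \<in> {w \<in> ?V. key w \<le> key v}" "v \<notin> {w \<in> ?V. key w \<le> key u}" using that by auto
      then show "{w \<in> ?V. key w \<le> key u} \<noteq> {w \<in> ?V. key w \<le> key v}" by blast
    qed
  qed (use fin in simp)
  have inj\<sigma>: "inj_on \<sigma> ?V"
  proof (rule inj_onI)
    fix u v assume "u \<in> ?V" "v \<in> ?V" "\<sigma> u = \<sigma> v"
    then have "key u = key v" using smono[of u v] smono[of v u] by (metis less_irrefl linorder_neqE_nat)
    then show "u = v" using inj \<open>u \<in> ?V\<close> \<open>v \<in> ?V\<close> by (auto dest: inj_onD)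
  qed
  have "\<sigma> ` ?V \<subseteq> {1..card ?V}"
  proof
    fix i assume "i \<in> \<sigma> ` ?V"
    then obtain v where v: "v \<in> ?V" "i = \<sigma> v" by blast
    then have "{w \<in> ?V. key w \<le> key v} \<noteq> {}" by blast
    then have "0 < i" using fin v by (simp add: \<sigma>_def card_gt_0_iff)
    moreover have "i \<le> card ?V" unfolding v \<sigma>_def using fin by (intro card_mono) auto
    ultimately show "i \<in> {1..card ?V}" by simp
  qed
  moreover have "card (\<sigma> ` ?V) = card ?V" by (rule card_image[OF inj\<sigma>])
  ultimately have "\<sigma> ` ?V = {1..card ?V}" by (intro card_subset_eq) auto
  then have "vertex_order G \<sigma>" using inj\<sigma> by (simp add: vertex_order_def bij_betw_def)
  moreover have "key u < key v" if "\<sigma> u < \<sigma> v" for u v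
    using that mono[of v u] by (meson leD not_le)
  ultimately show ?thesis by blast
qed

lemma finite_semi: "finite {card M | M. semi_induced_matching G \<sigma> M}"
  by (rule finite_subset[of _ "{..card (edges G)}"])
     (auto simp: semi_induced_matching_def matching_def intro: card_mono finite_verts)

lemma card_le_sim:
  assumes \<sigma>: "vertex_order G \<sigma>" and M: "semi_induced_matching G \<sigma> M"
  shows "card M \<le> sim G"
proof -
  have "card M \<le> sim_wrt G \<sigma>"
    unfolding sim_wrt_def using M finite_semi by (intro Max_ge) auto
  also have "\<dots> \<le> sim G"
    unfolding sim_def
  proof (rule Max_ge)
    \<comment> \<open>There are infinitely many orders, as their values outside
      \<open>verts G\<close> are free; finiteness of the outer maximum comes from bounding the
      values instead.\<close>
    have "sim_wrt G \<tau> \<le> card (edges G)" for \<tau>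
      unfolding sim_wrt_def
    proof (rule Max.boundedI[OF finite_semi])
      show "{card M | M. semi_induced_matching G \<tau> M} \<noteq> {}"
        by (auto simp: semi_induced_matching_def matching_def intro!: exI[of _ "{}"])
    qed (auto simp: semi_induced_matching_def matching_def intro: card_mono finite_verts)
    then show "finite {sim_wrt G \<sigma> | \<sigma>. vertex_order G \<sigma>}"
      by (auto intro: finite_subset[of _ "{..card (edges G)}"])
  qed (use \<sigma> in auto)
  finally show ?thesis .
qed

lemma solution_le_sim:
  assumes sol: "dcl_solution P L' A' f"
  shows "card A' \<le> sim G"
proof -
  have A': "A' \<subseteq> agents P" using sol by (simp add: dcl_solution_def)
  have f: "f a \<in> centers P" "f a \<in> L'" "{a, f a} \<in> edges G" if "a \<in> A'" for a
    using sol that by (auto simp: dcl_solution_def nbrs)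
  have finA: "finite A'" using A' finite_verts(2) finite_subset by blast
  have inj: "inj_on f A'"
  proof (rule inj_onI)
    fix a b assume ab: "a \<in> A'" "b \<in> A'" "f a = f b"
    have "int (card {c \<in> A'. f c = f a}) \<le> 1" using sol f[OF ab(1)] cap by (auto simp: dcl_solution_def)
    then have "card {c \<in> A'. f c = f a} \<le> Suc 0" by simp
    then show "a = b" using ab finA by (subst (asm) card_le_Suc0_iff_eq) auto
  qed
  have neq: "a \<noteq> f b" if "a \<in> A'" "b \<in> A'" for a b
    using that A' f disjoint by blast
  define M where "M = (\<lambda>a. {a, f a}) ` A'"
  have eq: "a = b" if "a \<in> A'" "b \<in> A'" "{a, f a} \<inter> {b, f b} \<noteq> {}" for a b
    using that neq inj by (auto dest: inj_onD)
  have "inj_on (\<lambda>a. {a, f a}) A'"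
    using eq by (intro inj_onI) blast
  then have cM: "card M = card A'" by (simp add: M_def card_image)
  have mat: "matching G M"
    unfolding matching_def
  proof (intro conjI ballI impI)
    show "M \<subseteq> edges G" using f(3) by (auto simp: M_def)
    fix e e' assume "e \<in> M" "e' \<in> M" "e \<noteq> e'"
    then obtain a b where ab: "a \<in> A'" "e = {a, f a}" "b \<in> A'" "e' = {b, f b}"
      by (auto simp: M_def)
    with \<open>e \<noteq> e'\<close> have "a \<noteq> b" by blast
    then show "e \<inter> e' = {}" using eq[OF ab(1,3)] unfolding ab(2,4) by argo
  qed
  obtain N where N: "\<And>v. v \<in> verts G \<Longrightarrow> v < N"
    using finite_verts(1) unfolding finite_nat_set_iff_bounded by blast
  \<comment> \<open>Assigned agents are sorted by their centers, which have numbers below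
    \<open>N\<close>; the shift by \<open>N\<close> puts all other vertices behind them and keeps
    the key injective.\<close>
  define key where "key v = (if v \<in> A' then f v else N + v)" for v
  have fN: "f a < N" if "a \<in> A'" for a using N f(1)[OF that] verts by blast
  have "inj_on key (verts G)"
  proof (rule inj_onI)
    fix u v assume "key u = key v"
    then show "u = v"
      using inj_onD[OF inj, of u v] fN[of u] fN[of v] by (auto simp: key_def split: if_splits)
  qed
  then obtain \<sigma> where \<sigma>: "vertex_order G \<sigma>"
    and key: "\<And>u v. u \<in> verts G \<Longrightarrow> v \<in> verts G \<Longrightarrow> \<sigma> u < \<sigma> v \<Longrightarrow> key u < key v"
    using vertex_order_of_key by blast
  \<comment> \<open>The agent of a matching edge always precedes its center, so the smaller endpoint
    is identified as the agent.\<close>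
  have first: "u \<in> A' \<and> u' = f u" if "{u, u'} \<in> M" "\<sigma> u < \<sigma> u'" for u u'
  proof -
    from that(1) obtain a where a: "a \<in> A'" "{u, u'} = {a, f a}" unfolding M_def by blast
    have "a \<in> verts G" "f a \<in> verts G" using a A' f verts by auto
    then have "\<not> \<sigma> (f a) < \<sigma> a"
      using key[of "f a" a] fN[OF a(1)] neq[of "f a" a] a(1) by (auto simp: key_def split: if_splits)
    then show ?thesis using a that(2) by (auto simp: doubleton_eq_iff)
  qed
  have "semi_induced_matching G \<sigma> M"
    unfolding semi_induced_matching_def
  proof (intro conjI mat allI impI; elim conjE)
    fix u u' v v'
    assume uv: "{u, u'} \<in> M" "{v, v'} \<in> M" "\<sigma> u < \<sigma> u'" "\<sigma> u < \<sigma> v" "\<sigma> v < \<sigma> v'"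
    have u: "u \<in> A'" "u' = f u" and v: "v \<in> A'" "v' = f v" using first uv by blast+
    show "{u, v} \<notin> edges G"
    proof
      assume "{u, v} \<in> edges G"
      then obtain a l where "a \<in> agents P" "l \<in> centers P" "{u, v} = {a, l}" using edge by blast
      then show False using u v A' disjoint by (auto simp: doubleton_eq_iff)
    qed
    \<comment> \<open>Earlier agents have worse centers. Were \<open>u\<close> adjacent to
      \<open>f v\<close>, it would have an open neighbour ranked above its assigned
      \<open>f u\<close>.\<close>
    have lt: "f u < f v" using key[OF _ _ uv(4)] u v A' verts by (auto simp: key_def)
    show "{u, v'} \<notin> edges G"
    proof
      assume "{u, v'} \<in> edges G"
      then have "f v \<in> nbrs P u \<inter> L'" using u v A' f by (auto simp: nbrs)
      then have "(f v, f u) \<in> pref P u" using sol u by (auto simp: dcl_solution_def)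
      then show False using lt u A' by (auto simp: pref)
    qed
  qed
  then show ?thesis using card_le_sim[OF \<sigma>] cM by metis
qed

lemma OPT_le_sim: "OPT P \<le> sim G"
  unfolding OPT_def
proof (rule Max.boundedI[OF finite_solution_sizes])
  have "dcl_solution P {} {} f" for f
    using cap by (auto simp: dcl_solution_def)
  then show "{card A' | L' A' f. dcl_solution P L' A' f} \<noteq> {}" by blast
qed (use solution_le_sim in auto)

end

section \<open>The reduction\<close>

abbreviation adjacent :: "'v ugraph \<Rightarrow> 'v \<Rightarrow> 'v \<Rightarrow> bool" where
  "adjacent G u v \<equiv> {u, v} \<in> edges G"

text \<open>Centers are the vertices of colour other than 2, so the vertex set is split for every
  graph, whether or not the colouring is proper; the facts about the encoding thus hold
  unconditionally. For a proper colouring the neighbours of an agent are automatically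
  centers.\<close>

definition reduction :: "nat ugraph \<Rightarrow> nat dcl_instance" where
  "reduction G = (let n = card (verts G); c = colouring n (adjacent G) in
     \<lparr>agents = {v. v < n \<and> c v = 2}, centers = {v. v < n \<and> c v \<noteq> 2},
      arcs = {(u, v). u < n \<and> v < n \<and> c u = 2 \<and> adjacent G u v}, cap = \<lambda>_. 1,
      pref = \<lambda>a. {(x, y). x < n \<and> y < n \<and> adjacent G a x \<and> adjacent G a y \<and> x \<le> y}\<rparr>)"

lemma dcl_verts_reduction: "dcl_verts (reduction G) = {..<card (verts G)}"
  by (auto simp: dcl_verts_def reduction_def Let_def)

text \<open>The given bipartition only certifies that a proper colouring exists; the computed
  classes may differ from it by swaps within components.\<close>

lemma bipartite_instance_reduction:
  assumes s: "simple_graph G" and b: "bipartite G" and e: "encodable_ugraph G"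
  shows "bipartite_instance G (reduction G)"
proof -
  define n where "n = card (verts G)"
  let ?E = "adjacent G"
  let ?c = "colouring n ?E"
  have V: "verts G = {..<n}" using e by (simp add: encodable_ugraph_def n_def)
  obtain X Y where XY: "X \<union> Y = verts G" "X \<inter> Y = {}"
    "\<forall>e\<in>edges G. \<exists>x\<in>X. \<exists>y\<in>Y. e = {x, y}"
    using b by (auto simp: bipartite_def)
  have "proper n ?E (\<lambda>v. if v \<in> X then 2 else 3)"
    unfolding proper_def
  proof (intro conjI allI impI)
    fix u v assume "{u, v} \<in> edges G"
    then obtain x y where "x \<in> X" "y \<in> Y" "{u, v} = {x, y}" using XY(3) by blast
    then show "(if u \<in> X then 2 else 3 :: nat) \<noteq> (if v \<in> X then 2 else 3)"
      using XY(2) by (auto simp: doubleton_eq_iff)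
  qed simp
  then have c: "\<forall>v<n. ?c v = 2 \<or> ?c v = 3" "\<forall>u<n. \<forall>v<n. ?E u v \<longrightarrow> ?c u \<noteq> ?c v"
    using colouring_proper[of n ?E] by (auto simp: insert_commute)
  have edge: "\<exists>u v. e = {u, v} \<and> u < n \<and> v < n" if "e \<in> edges G" for e
    using s that V by (fastforce simp: simple_graph_def card_2_iff)
  note red = reduction_def[of G, folded n_def, unfolded Let_def]
  show ?thesis
  proof
    show "verts G = agents (reduction G) \<union> centers (reduction G)"
      by (auto simp: red V)
    show "agents (reduction G) \<inter> centers (reduction G) = {}" by (auto simp: red)
    show "\<exists>a\<in>agents (reduction G). \<exists>l\<in>centers (reduction G). e = {a, l}" if "e \<in> edges G" for e
    proof -
      from edge[OF that] obtain u v where uv: "e = {u, v}" "u < n" "v < n" by blast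
      then have "?c u = 2 \<and> ?c v = 3 \<or> ?c u = 3 \<and> ?c v = 2" using c that by metis
      then have "u \<in> agents (reduction G) \<and> v \<in> centers (reduction G) \<or>
          v \<in> agents (reduction G) \<and> u \<in> centers (reduction G)"
        using uv by (auto simp: red)
      then show ?thesis unfolding uv(1) by (metis insert_commute)
    qed
    show "arcs (reduction G) = {(a, l). a \<in> agents (reduction G) \<and> l \<in> centers (reduction G) \<and>
        {a, l} \<in> edges G}"
      using c by (auto simp: red)
    show "pref (reduction G) a = {(x, y). x \<in> nbrs (reduction G) a \<and> y \<in> nbrs (reduction G) a \<and> x \<le> y}"
      if "a \<in> agents (reduction G)" for a
      using that by (auto simp: red nbrs_def)
  qed (use s in \<open>simp_all add: red\<close>)
qed

lemma enc_int_1: "enc_int 1 = [False, True, True, False]"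
  by (simp add: enc_int_def enc_nat.simps)

lemma enc_dcl_reduction:
  "enc_dcl (reduction G) = red_code (card (verts G)) (adjacent G) (colouring (card (verts G)) (adjacent G))"
proof -
  define n where "n = card (verts G)"
  define c where "c = colouring n (adjacent G)"
  note red = reduction_def[of G, folded n_def, unfolded Let_def, folded c_def]
  have n: "card (dcl_verts (reduction G)) = n" by (simp add: dcl_verts_reduction n_def)
  have 1: "map (\<lambda>v. v \<in> agents (reduction G)) [0..<n] = map (\<lambda>v. c v = 2) [0..<n]"
    by (simp add: red)
  have 2: "concat (map (\<lambda>u. map (\<lambda>v. (u, v) \<in> arcs (reduction G)) [0..<n]) [0..<n]) =
      arcs_code n (adjacent G) c n"
    unfolding arcs_code_def by (intro arg_cong[of _ _ concat] map_cong refl) (simp add: red)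
  \<comment> \<open>Stated for prefixes to permit induction: the block of a vertex is empty or four
    bits long, depending on its colour.\<close>
  have 3: "concat (concat (map (\<lambda>l. if l \<in> centers (reduction G) then [enc_int (cap (reduction G) l)] else []) [0..<m])) =
      caps_code c m" if "m \<le> n" for m
    using that by (induction m) (simp_all add: caps_code_def red enc_int_1)
  have 4: "concat (map (\<lambda>a. if a \<in> agents (reduction G)
        then concat (map (\<lambda>x. map (\<lambda>y. (x, y) \<in> pref (reduction G) a) [0..<n]) [0..<n]) else []) [0..<n]) =
      prefs_code n (adjacent G) c n"
    unfolding prefs_code_def row_code_def
    by (intro arg_cong[of _ _ concat] map_cong refl if_cong) (simp_all add: red)
  show ?thesis
    unfolding enc_dcl_def n Let_def 1 2 3[OF order_refl] 4 red_code_def n_def[symmetric] c_def[symmetric] ..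
qed

text \<open>The program computes \<open>reduction\<close> on the code of every graph, so the domain
  is arbitrary. Since \<open>n\<close> is written in unary it is at most the input length, and a
  bound in \<open>n\<close> becomes one in that length.\<close>

lemma polytime_reduction: "polytime_computable_on D enc_ugraph enc_dcl reduction"
proof -
  obtain M where M: "wf_tm M" "\<And>w N s v. runs 6 red_prog (init_store w) N s \<Longrightarrow>
      fst (s 1) = word_tape v \<Longrightarrow> outputs_within M w N v"
    using prog_to_tm[OF wf_red_prog] by auto
  obtain p where p: "\<And>n. red_cost n = poly p n"
    using poly_bound_red_cost by (auto simp: poly_bound_def)
  have "outputs_within M (enc_ugraph G) (poly p (length (enc_ugraph G))) (enc_dcl (reduction G))" for G
  proof -
    let ?n = "card (verts G)"
    have "?n \<le> length (enc_ugraph G)" by (simp add: enc_ugraph_def Let_def enc_unary_def)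
    then have le: "red_cost ?n \<le> poly p (length (enc_ugraph G))" unfolding p by (rule poly_nat_mono)
    have w: "enc_ugraph G = enc_unary ?n @ concat (map (\<lambda>u. map (\<lambda>v. adjacent G u v) [0..<?n]) [0..<?n])"
      by (simp add: enc_ugraph_def Let_def)
    obtain s where "runs 6 red_prog (init_store (enc_ugraph G)) (red_cost ?n) s"
      "fst (s 1) = word_tape (enc_dcl (reduction G))"
      using red_runs[of ?n "adjacent G"] unfolding w enc_dcl_reduction by blast
    then show ?thesis using M(2) runs_mono le by blast
  qed
  then show ?thesis unfolding polytime_computable_on_def using M(1) by blast
qed

theorem theorem6p5:
  shows "\<exists>red :: nat ugraph \<Rightarrow> nat dcl_instance.
     polytime_computable_on {G'. simple_graph G' \<and> bipartite G' \<and> encodable_ugraph G'}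
       enc_ugraph enc_dcl red \<and>
     (\<forall>G'. simple_graph G' \<and> bipartite G' \<and> encodable_ugraph G' \<longrightarrow>
        valid_dcl (red G') \<and> encodable_dcl (red G') \<and>
        im G' \<le> OPT (red G') \<and> OPT (red G') \<le> sim G' \<and>
        card (dcl_verts (red G')) = card (verts G') \<and>
        (\<forall>l\<in>centers (red G'). cap (red G') l = 1) \<and>
        (\<exists>R. linear_order_on (centers (red G')) R \<and>
             (\<forall>a\<in>agents (red G'). pref (red G') a = Restr R (nbrs (red G') a))))"
proof (intro exI[of _ reduction] conjI polytime_reduction allI impI; elim conjE)
  fix G :: "nat ugraph"
  assume G: "simple_graph G" "bipartite G" "encodable_ugraph G"
  interpret bipartite_instance G "reduction G" by (rule bipartite_instance_reduction[OF G])
  let ?P = "reduction G"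
  show "valid_dcl ?P" "im G \<le> OPT ?P" "OPT ?P \<le> sim G"
    by (fact valid im_le_OPT OPT_le_sim)+
  show "encodable_dcl ?P" "card (dcl_verts ?P) = card (verts G)"
    by (simp_all add: encodable_dcl_def dcl_verts_reduction)
  show "\<forall>l\<in>centers ?P. cap ?P l = 1" using cap by blast
  \<comment> \<open>The global preference orders the centers by vertex number; neighbourhoods
    consist of centers, so its restrictions are the individual rankings.\<close>
  let ?R = "{(x, y). x \<in> centers ?P \<and> y \<in> centers ?P \<and> x \<le> y}"
  have "linear_order_on (centers ?P) ?R"
    unfolding linear_order_on_def partial_order_on_def preorder_on_def
    by (auto simp: refl_on_def trans_def antisym_def total_on_def)
  moreover have "\<forall>a\<in>agents ?P. pref ?P a = Restr ?R (nbrs ?P a)"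
    by (auto simp: pref nbrs)
  ultimately show "\<exists>R. linear_order_on (centers ?P) R \<and>
      (\<forall>a\<in>agents ?P. pref ?P a = Restr R (nbrs ?P a))" by blast
qed

end
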